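(* Let $\mathcal{C} = \{(-1,0), (0,2), (1,-1), (2,1)\}$. Then for every integer $n > 10$, $\mathcal{C}$ is an $n$-optimal $4$-configuration.
   Context: For $n \in \mathbb{N}$ let $I_n = \{\lfloor (2-n)/2 \rfloor, \ldots, \lfloor n/2 \rfloor\}$ and $\mathcal{B}_n = I_n \times I_n$. A configuration is a finite set $\mathcal{C} \subset \mathbb{Z}\times\mathbb{Z}$; a $q$-configuration has $|\mathcal{C}| = q$. For $Q=(x,y)$, $A(Q) = \{(x+i,y),(x,y+i),(x+i,y+i),(x+i,y-i) : i \in \mathbb{Z}\setminus\{0\}\}$ and $A(\mathcal{C}) = \bigcup_{Q\in\mathcal{C}} A(Q)$. The cover is $\mathrm{cover}_n(\mathcal{C}) = |(\mathcal{C}\cup A(\mathcal{C}))\cap \mathcal{B}_n|$. A $q$-configuration $\mathcal{C}\subset\mathcal{B}_n$ is $n$-optimal if $\mathrm{cover}_n(\mathcal{C}') \le \mathrm{cover}_n(\mathcal{C})$ for every $q$-configuration $\mathcal{C}'\subset \mathcal{B}_n$. *)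

theory Defs
  imports Main
begin

definition I_n :: "nat \<Rightarrow> int set" where
  "I_n n = {(2 - int n) div 2 .. int n div 2}"

definition B_n :: "nat \<Rightarrow> (int \<times> int) set" where
  "B_n n = I_n n \<times> I_n n"

definition attacked :: "int \<times> int \<Rightarrow> (int \<times> int) set" where
  "attacked Q = (case Q of (x, y) \<Rightarrow>
     {(x + i, y) | i. i \<noteq> 0} \<union> {(x, y + i) | i. i \<noteq> 0} \<union>
     {(x + i, y + i) | i. i \<noteq> 0} \<union> {(x + i, y - i) | i. i \<noteq> 0})"

definition attacked_set :: "(int \<times> int) set \<Rightarrow> (int \<times> int) set" where
  "attacked_set C = (\<Union>Q\<in>C. attacked Q)"

definition cover :: "nat \<Rightarrow> (int \<times> int) set \<Rightarrow> nat" where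
  "cover n C = card ((C \<union> attacked_set C) \<inter> B_n n)"

definition n_optimal :: "nat \<Rightarrow> nat \<Rightarrow> (int \<times> int) set \<Rightarrow> bool" where
  "n_optimal n q C \<longleftrightarrow> finite C \<and> card C = q \<and> C \<subseteq> B_n n \<and>
     (\<forall>C'. finite C' \<and> card C' = q \<and> C' \<subseteq> B_n n \<longrightarrow> cover n C' \<le> cover n C)"

end

theory Submission
  imports Defs
begin

text \<open>
  The configuration covers exactly \<open>16 n - 72\<close> squares for every \<open>n \<ge> 11\<close>: passing from \<open>n\<close> to
  \<open>n + 1\<close> adds 16 covered squares. It remains to show that four queens never cover more.

  The rows and columns of the queens leave a grid of free squares. The number of free squares on the two
  diagonals of a queen (its gain) bounds what it can add to them; it is small for queens close to the border.

  Upper bound by induction on \<open>n\<close>: suppose that two adjacent border lines of the board, say the last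
  column and the first row, contain no queen. Deleting them loses at most 16 covered squares, unless at
  least three distinct diagonals \<open>x - y = d\<close> with \<open>d \<ge> 0\<close> are occupied. After symmetries, what survives is
  either a pair of queens on opposite border lines, or a queen on the last row together with three queens
  on distinct diagonals \<open>d \<ge> 0\<close>. The border queens have such small gains that the bound is immediate for
  \<open>n \<ge> 16\<close> and \<open>n \<ge> 28\<close> respectively; for smaller \<open>n\<close> the few remaining positions are searched.
  The base case \<open>n = 11\<close> is a branch-and-bound search over the sets of occupied columns and rows.
\<close>

section \<open>Counting covered squares\<close>

text \<open>Four distinct rows and columns cover \<open>8 n - 16\<close> squares, and each queen
  gains at most \<open>2 n - 8\<close> more, which gives only \<open>16 n - 48\<close>: the bound to
  be proved asks for 24 squares less. Estimates of single gains find these 24 squares only for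
  queens near the border. For central queens part of the loss lies in the crossings of diagonals of
  different queens, which such estimates do not see; the induction carries this part down to the
  finite search instead of analysing it for every \<open>n\<close>. A border queen alone falls short
  by \<open>n - 4\<close>, since just one square per free column remains to it. One such queen
  therefore suffices if \<open>n - 4 >= 24\<close>, and two suffice if
  \<open>2 (n - 4) >= 24\<close>; this is the origin of the thresholds 28 and 16.\<close>

definition board :: "nat \<Rightarrow> (nat \<times> nat) set" where
  "board n = {..<n} \<times> {..<n}"

definition hits :: "nat \<times> nat \<Rightarrow> nat \<times> nat \<Rightarrow> bool" where
  "hits q p \<longleftrightarrow> fst p = fst q \<or> snd p = snd q \<or>
     fst p + snd q = fst q + snd p \<or> fst p + snd p = fst q + snd q"

definition covered :: "nat \<Rightarrow> (nat \<times> nat) set \<Rightarrow> (nat \<times> nat) set" where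
  "covered n C = {p \<in> board n. \<exists>q\<in>C. hits q p}"

definition good :: "nat \<Rightarrow> (nat \<times> nat) set \<Rightarrow> bool" where
  "good n C \<longleftrightarrow> card (covered n C) + 72 \<le> 16 * n"

text \<open>Columns are counted instead of squares: a diagonal meets each column at most once, so
  the count compares directly with the \<open>n - card X\<close> free columns.\<close>

definition diag_free :: "nat \<Rightarrow> nat set \<Rightarrow> nat set \<Rightarrow> nat \<times> nat \<Rightarrow> nat" where
  "diag_free n X Y q = card {x. x < n \<and> x \<notin> X \<and> (\<exists>y<n. y \<notin> Y \<and> x + snd q = fst q + y)}"

definition anti_free :: "nat \<Rightarrow> nat set \<Rightarrow> nat set \<Rightarrow> nat \<times> nat \<Rightarrow> nat" where
  "anti_free n X Y q = card {x. x < n \<and> x \<notin> X \<and> (\<exists>y<n. y \<notin> Y \<and> x + y = fst q + snd q)}"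

definition gain :: "nat \<Rightarrow> nat set \<Rightarrow> nat set \<Rightarrow> nat \<times> nat \<Rightarrow> nat" where
  "gain n X Y q = diag_free n X Y q + anti_free n X Y q"

lemma finite_board [simp]: "finite (board n)"
  by (simp add: board_def)

lemma card_board: "card (board n) = n * n"
  by (simp add: board_def)

lemma finite_covered [simp]: "finite (covered n C)"
  by (simp add: covered_def)

lemma diag_free_pairs:
  "diag_free n X Y q = card {p \<in> ({..<n} - X) \<times> ({..<n} - Y). fst p + snd q = fst q + snd p}"
proof -
  let ?D = "{p \<in> ({..<n} - X) \<times> ({..<n} - Y). fst p + snd q = fst q + snd p}"
  have "{x. x < n \<and> x \<notin> X \<and> (\<exists>y<n. y \<notin> Y \<and> x + snd q = fst q + y)} = fst ` ?D" by force
  moreover have "inj_on fst ?D" by (auto simp: inj_on_def)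
  ultimately show ?thesis unfolding diag_free_def by (simp add: card_image)
qed

lemma anti_free_pairs:
  "anti_free n X Y q = card {p \<in> ({..<n} - X) \<times> ({..<n} - Y). fst p + snd p = fst q + snd q}"
proof -
  let ?D = "{p \<in> ({..<n} - X) \<times> ({..<n} - Y). fst p + snd p = fst q + snd q}"
  have "{x. x < n \<and> x \<notin> X \<and> (\<exists>y<n. y \<notin> Y \<and> x + y = fst q + snd q)} = fst ` ?D" by force
  moreover have "inj_on fst ?D" by (auto simp: inj_on_def)
  ultimately show ?thesis unfolding anti_free_def by (simp add: card_image)
qed

text \<open>A covered square either lies on an occupied line, hence outside the grid of free
  squares, or is on a diagonal of some queen inside the grid. Slack arises from squares on diagonals
  of several queens. The list \<open>qs\<close> may repeat queens, so that four summands are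
  available for smaller configurations too.\<close>

lemma card_covered_le_gain:
  assumes C: "C \<subseteq> board n" and qs: "set qs = C"
  shows "card (covered n C) + (n - card (fst ` C)) * (n - card (snd ` C))
    \<le> n * n + (\<Sum>q\<leftarrow>qs. gain n (fst ` C) (snd ` C) q)"
proof -
  define X where "X = fst ` C"
  define Y where "Y = snd ` C"
  have X: "X \<subseteq> {..<n}" and Y: "Y \<subseteq> {..<n}" using C by (auto simp: X_def Y_def board_def)
  let ?F = "({..<n} - X) \<times> ({..<n} - Y)"
  define D where "D q = {p \<in> ?F. fst p + snd q = fst q + snd p}" for q :: "nat \<times> nat"
  define A where "A q = {p \<in> ?F. fst p + snd p = fst q + snd q}" for q :: "nat \<times> nat"
  have cF: "card ?F = (n - card X) * (n - card Y)"
    using X Y by (simp add: card_cartesian_product card_Diff_subset finite_subset)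
  have cD: "card (D q) = diag_free n X Y q" and cA: "card (A q) = anti_free n X Y q" for q
    by (simp_all add: D_def A_def diag_free_pairs anti_free_pairs)
  have fin: "finite (D q)" "finite (A q)" for q by (auto simp: D_def A_def)
  have un: "card (\<Union>q\<in>set l. D q \<union> A q) \<le> (\<Sum>q\<leftarrow>l. gain n X Y q)" for l
  proof (induction l)
    case (Cons q l)
    have "card (\<Union>q\<in>set (q # l). D q \<union> A q) \<le> card (D q \<union> A q) + card (\<Union>q\<in>set l. D q \<union> A q)"
      by (simp add: card_Un_le)
    also have "card (D q \<union> A q) \<le> gain n X Y q"
      unfolding gain_def using card_Un_le[of "D q" "A q"] cD[of q] cA[of q] by simp
    finally show ?case using Cons by simp
  qed simp
  have sub: "covered n C \<subseteq> (board n - ?F) \<union> (\<Union>q\<in>set qs. D q \<union> A q)"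
  proof
    fix p assume p: "p \<in> covered n C"
    then obtain q where q: "q \<in> C" "hits q p" and pb: "p \<in> board n" by (auto simp: covered_def)
    show "p \<in> (board n - ?F) \<union> (\<Union>q\<in>set qs. D q \<union> A q)"
    proof (cases "p \<in> ?F")
      case True
      then have "fst p \<noteq> fst q" "snd p \<noteq> snd q" using q(1) by (auto simp: X_def Y_def)
      then have "p \<in> D q \<union> A q" using q(2) True by (auto simp: hits_def D_def A_def)
      then show ?thesis using q(1) qs by blast
    qed (use pb in simp)
  qed
  have FB: "?F \<subseteq> board n" by (auto simp: board_def)
  have "card (covered n C) \<le> card (board n - ?F) + card (\<Union>q\<in>set qs. D q \<union> A q)"
    by (rule order_trans[OF card_mono[OF _ sub] card_Un_le]) (auto simp: fin)
  also have "card (board n - ?F) = n * n - card ?F"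
    using FB by (simp add: card_Diff_subset card_board finite_subset[OF FB])
  finally have "card (covered n C) \<le> n * n - card ?F + (\<Sum>q\<leftarrow>qs. gain n X Y q)"
    using un[of qs] by simp
  moreover have "card ?F \<le> n * n" using card_mono[OF _ FB] by (simp add: card_board)
  ultimately show ?thesis using cF by (simp add: X_def Y_def)
qed

lemma gain_mono:
  assumes "X \<subseteq> X'" "Y \<subseteq> Y'"
  shows "gain n X' Y' q \<le> gain n X Y q"
  unfolding gain_def diag_free_def anti_free_def
  by (intro add_mono card_mono) (use assms in auto)

lemma diag_free_le:
  assumes "X \<subseteq> {..<n}"
  shows "diag_free n X Y q \<le> n - card X"
proof -
  have "diag_free n X Y q \<le> card ({..<n} - X)"
    unfolding diag_free_def by (rule card_mono) auto
  then show ?thesis using assms by (simp add: card_Diff_subset finite_subset)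
qed

lemma anti_free_le:
  assumes "X \<subseteq> {..<n}"
  shows "anti_free n X Y q \<le> n - card X"
proof -
  have "anti_free n X Y q \<le> card ({..<n} - X)"
    unfolding anti_free_def by (rule card_mono) auto
  then show ?thesis using assms by (simp add: card_Diff_subset finite_subset)
qed

lemma diag_free_swap: "diag_free n Y X (prod.swap q) = diag_free n X Y q"
proof -
  have "{p \<in> ({..<n} - Y) \<times> ({..<n} - X). fst p + fst q = snd q + snd p} =
    prod.swap ` {p \<in> ({..<n} - X) \<times> ({..<n} - Y). fst p + snd q = fst q + snd p}"
    by (auto simp: image_iff Bex_def)
  then show ?thesis by (simp add: diag_free_pairs card_image)
qed

lemma anti_free_swap: "anti_free n Y X (prod.swap q) = anti_free n X Y q"
proof -
  have "{p \<in> ({..<n} - Y) \<times> ({..<n} - X). fst p + snd p = snd q + fst q} =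
    prod.swap ` {p \<in> ({..<n} - X) \<times> ({..<n} - Y). fst p + snd p = fst q + snd q}"
    by (auto simp: image_iff Bex_def)
  then show ?thesis by (simp add: anti_free_pairs card_image)
qed

lemma gain_swap: "gain n Y X (prod.swap q) = gain n X Y q"
  by (simp add: gain_def diag_free_swap anti_free_swap)

lemma gain_le_cols: "X \<subseteq> {..<n} \<Longrightarrow> gain n X Y q \<le> 2 * (n - card X)"
  using diag_free_le[of X n Y q] anti_free_le[of X n Y q] by (simp add: gain_def)

text \<open>Apart from its own column, only the columns at distance at most \<open>min b (n - 1 - b)\<close>
  from a queen in row \<open>b\<close> meet both of its diagonals inside the board.\<close>

lemma gain_le_row_margin:
  assumes X: "X \<subseteq> {..<n}" and q: "q \<in> board n" and qX: "fst q \<in> X"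
  shows "gain n X Y q \<le> n - card X + 2 * min (snd q) (n - 1 - snd q)"
proof -
  obtain a b where ab: "q = (a, b)" by (cases q)
  define k where "k = min b (n - 1 - b)"
  let ?D = "{x. x < n \<and> x \<notin> X \<and> (\<exists>y<n. y \<notin> Y \<and> x + snd q = fst q + y)}"
  let ?A = "{x. x < n \<and> x \<notin> X \<and> (\<exists>y<n. y \<notin> Y \<and> x + y = fst q + snd q)}"
  have fin: "finite ?D" "finite ?A" by auto
  have "?D \<inter> ?A \<subseteq> {a - k..<a} \<union> {a<..a + k}"
  proof
    fix x assume x: "x \<in> ?D \<inter> ?A"
    then obtain y y' where y: "y < n" "x + b = a + y" "y' < n" "x + y' = a + b" by (auto simp: ab)
    moreover have "x \<noteq> a" using x qX ab by auto
    ultimately show "x \<in> {a - k..<a} \<union> {a<..a + k}" unfolding k_def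
      using q by (auto simp: ab board_def min_def)
  qed
  then have "card (?D \<inter> ?A) \<le> card ({a - k..<a} \<union> {a<..a + k})" by (intro card_mono) auto
  also have "\<dots> \<le> 2 * k" using card_Un_le[of "{a - k..<a}" "{a<..a + k}"] by simp
  finally have i: "card (?D \<inter> ?A) \<le> 2 * k" .
  have "card (?D \<union> ?A) \<le> card ({..<n} - X)" by (rule card_mono) auto
  also have "\<dots> = n - card X" using X by (simp add: card_Diff_subset finite_subset)
  finally have u: "card (?D \<union> ?A) \<le> n - card X" .
  have "gain n X Y q = card (?D \<union> ?A) + card (?D \<inter> ?A)"
    unfolding gain_def diag_free_def anti_free_def by (rule card_Un_Int[OF fin])
  then show ?thesis using i u by (simp add: k_def ab)
qed

definition margin :: "nat \<Rightarrow> nat \<times> nat \<Rightarrow> nat" where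
  "margin n q = min (min (fst q) (n - 1 - fst q)) (min (snd q) (n - 1 - snd q))"

text \<open>The row estimate and its transpose, used for whichever border line is nearest;
  \<open>min (card X) (card Y)\<close> makes one bound serve both.\<close>

lemma gain_le_margin:
  assumes X: "X \<subseteq> {..<n}" and Y: "Y \<subseteq> {..<n}" and q: "q \<in> board n" and "fst q \<in> X" "snd q \<in> Y"
  shows "gain n X Y q \<le> n - min (card X) (card Y) + 2 * margin n q"
proof -
  have 1: "gain n X Y q \<le> n - card X + 2 * min (snd q) (n - 1 - snd q)"
    using gain_le_row_margin assms by blast
  have 2: "gain n X Y q \<le> n - card Y + 2 * min (fst q) (n - 1 - fst q)"
    using gain_le_row_margin[OF Y, of "prod.swap q" X] assms
    by (auto simp: gain_swap board_def)
  have *: "gain n X Y q \<le> n - min (card X) (card Y) + 2 * min (snd q) (n - 1 - snd q)"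
    by (rule order_trans[OF 1]) (simp only: add_le_mono1 diff_le_mono2 min.cobounded1)
  have **: "gain n X Y q \<le> n - min (card X) (card Y) + 2 * min (fst q) (n - 1 - fst q)"
    by (rule order_trans[OF 2]) (simp only: add_le_mono1 diff_le_mono2 min.cobounded2)
  have "margin n q = min (fst q) (n - 1 - fst q) \<or> margin n q = min (snd q) (n - 1 - snd q)"
    unfolding margin_def using linear[of "min (fst q) (n - 1 - fst q)" "min (snd q) (n - 1 - snd q)"]
    by (elim disjE) (simp_all only: min.absorb1 min.absorb2 simp_thms)
  then show ?thesis using * ** by (elim disjE) (simp_all only:)
qed

lemma card_image_fst_snd:
  assumes "C \<subseteq> board n" "card C \<le> 4"
  shows "card (fst ` C) \<le> 4" "card (snd ` C) \<le> 4" "fst ` C \<subseteq> {..<n}" "snd ` C \<subseteq> {..<n}"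
proof -
  have "finite C" using assms(1) finite_subset by (blast intro: finite_board)
  then show "card (fst ` C) \<le> 4" "card (snd ` C) \<le> 4"
    using card_image_le[of C fst] card_image_le[of C snd] assms(2) by auto
qed (use assms(1) in \<open>auto simp: board_def\<close>)

text \<open>Here \<open>K\<close> stands for the number of covered squares and \<open>G\<close> for
  the total gain. With \<open>m = n - 4\<close> and \<open>k\<close>, \<open>l\<close> missing
  columns and rows, the free grid has \<open>(m + k) (m + l)\<close> squares, so every coincidence
  of lines costs \<open>m\<close> squares.\<close>

lemma square_minus_free:
  fixes n c r K :: nat
  assumes "K + (n - c) * (n - r) \<le> n * n + G" "c \<le> 4" "r \<le> 4" "4 \<le> n"
  shows "K + (8 - c - r) * (n - 4) + (4 - c) * (4 - r) + 16 \<le> 8 * n + G"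
proof -
  define m k l where "m = n - 4" and "k = 4 - c" and "l = 4 - r"
  have "n = m + 4" "n - c = m + k" "n - r = m + l" "8 - c - r = k + l"
    using assms by (auto simp: m_def k_def l_def)
  then show ?thesis using assms(1) by (simp add: algebra_simps m_def[symmetric] k_def[symmetric] l_def[symmetric])
qed

text \<open>With four distinct columns and rows the total gain must stay below
  \<open>8 n - 56\<close>. Coinciding lines raise each gain bound by at most \<open>e\<close>, but
  cost \<open>(8 - c - r) * (n - 4)\<close> squares; from \<open>n = 12\<close> on this outweighs
  the increase \<open>4 * e\<close>.\<close>

lemma good_of_margins:
  assumes n: "12 \<le> n" and C: "C \<subseteq> board n" "card C \<le> 4" and qs: "set qs = C" "length qs = 4"
    and le: "(\<Sum>q\<leftarrow>qs. min (2 * n - 8) (n - 4 + 2 * margin n q)) + 56 \<le> 8 * n"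
  shows "good n C"
proof -
  define c r where "c = card (fst ` C)" and "r = card (snd ` C)"
  note X = card_image_fst_snd[OF C]
  define e where "e = 2 * (8 - c - r)"
  have g: "gain n (fst ` C) (snd ` C) q \<le> min (2 * n - 8) (n - 4 + 2 * margin n q) + e" if "q \<in> C" for q
  proof -
    have "gain n (fst ` C) (snd ` C) q \<le> 2 * (n - c)" using gain_le_cols[OF X(3)] by (simp add: c_def)
    moreover have "gain n (fst ` C) (snd ` C) q \<le> n - min c r + 2 * margin n q"
      unfolding c_def r_def by (rule gain_le_margin[OF X(3,4)]) (use that C in auto)
    moreover have "2 * (n - c) \<le> 2 * n - 8 + e" "n - min c r \<le> n - 4 + e"
      using X(1,2) n unfolding e_def c_def[symmetric] r_def[symmetric] by linarith+
    ultimately show ?thesis unfolding min_add_distrib_left min.bounded_iff by linarith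
  qed
  have "(\<Sum>q\<leftarrow>qs. gain n (fst ` C) (snd ` C) q)
      \<le> (\<Sum>q\<leftarrow>qs. min (2 * n - 8) (n - 4 + 2 * margin n q) + e)"
    using g qs by (intro sum_list_mono) auto
  also have "\<dots> = (\<Sum>q\<leftarrow>qs. min (2 * n - 8) (n - 4 + 2 * margin n q)) + 4 * e"
    using qs by (simp add: sum_list_addf sum_list_triv)
  finally have G: "(\<Sum>q\<leftarrow>qs. gain n (fst ` C) (snd ` C) q) + 56 \<le> 8 * n + 4 * e" using le by linarith
  have "card (covered n C) + (8 - c - r) * (n - 4) + (4 - c) * (4 - r) + 16 \<le>
      8 * n + (\<Sum>q\<leftarrow>qs. gain n (fst ` C) (snd ` C) q)"
    unfolding c_def r_def
    by (rule square_minus_free[OF card_covered_le_gain[OF C(1) qs(1)]]) (use X n in auto)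
  moreover have "4 * e \<le> (8 - c - r) * (n - 4)"
  proof -
    have "(8 - c - r) * 8 \<le> (8 - c - r) * (n - 4)" using n by (intro mult_le_mono2) simp
    then show ?thesis by (simp add: e_def)
  qed
  ultimately show ?thesis using G unfolding good_def by linarith
qed

text \<open>The border queen \<open>e\<close> gains at most one square per free column. Its own
  column is left out of \<open>X3\<close>, so the gains of the other three are overestimated in a
  way that is valid for every position of \<open>e\<close> on its row. One check of three queens
  thus settles all these positions.\<close>

lemma good_of_three_gains:
  assumes n: "12 \<le> n" and C: "C \<subseteq> board n" "C = {e, p, q, r}" and e: "snd e = 0 \<or> snd e = n - 1"
    and X3: "X3 = fst ` {p, q, r}"
    and le: "gain n X3 (snd ` C) p + gain n X3 (snd ` C) q + gain n X3 (snd ` C) r + 52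
      \<le> 7 * n + (if card X3 < 3 \<or> card (snd ` C) < 4 then n - 5 else 0)"
  shows "good n C"
proof -
  have cC: "card C \<le> 4" unfolding C(2) by (auto intro!: card_insert_le_m1)
  define k l where "k = 4 - card (fst ` C)" and "l = 4 - card (snd ` C)"
  note X = card_image_fst_snd[OF C(1) cC]
  have mono: "gain n (fst ` C) (snd ` C) z \<le> gain n X3 (snd ` C) z" for z
    by (rule gain_mono) (auto simp: X3 C(2))
  have "gain n (fst ` C) (snd ` C) e \<le> n - card (fst ` C) + 2 * min (snd e) (n - 1 - snd e)"
    by (rule gain_le_row_margin) (use X C in auto)
  then have ge: "gain n (fst ` C) (snd ` C) e \<le> n - card (fst ` C)" using e by auto
  have "card (covered n C) + (n - card (fst ` C)) * (n - card (snd ` C)) \<le> n * n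
      + (\<Sum>q\<leftarrow>[e, p, q, r]. gain n (fst ` C) (snd ` C) q)"
    by (rule card_covered_le_gain[OF C(1)]) (simp add: C(2))
  note square_minus_free[OF this]
  moreover have "8 - card (fst ` C) - card (snd ` C) = k + l" using X by (simp add: k_def l_def)
  ultimately have "card (covered n C) + (k + l) * (n - 4) + 16
      \<le> 8 * n + (\<Sum>q\<leftarrow>[e, p, q, r]. gain n (fst ` C) (snd ` C) q)" using X n by simp
  moreover have "n - card (fst ` C) = n - 4 + k" using X n by (simp add: k_def)
  ultimately have main: "card (covered n C) + (k + l) * (n - 4) + 16 \<le> 8 * n + (n - 4 + k)
    + (gain n X3 (snd ` C) p + gain n X3 (snd ` C) q + gain n X3 (snd ` C) r)"
    using ge mono[of p] mono[of q] mono[of r] by simp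
  have "fst ` C = insert (fst e) X3" by (auto simp: C(2) X3)
  moreover have "finite X3" by (simp add: X3)
  ultimately have cX: "card (fst ` C) \<le> Suc (card X3)" by (simp add: card_insert_if)
  have kn: "k \<le> k * (n - 4)" 
  proof -
    have "k * 1 \<le> k * (n - 4)" using n by (intro mult_le_mono2) simp
    then show ?thesis by simp
  qed
  show ?thesis
  proof (cases "card X3 < 3 \<or> card (snd ` C) < 4")
    case False
    have "k \<le> (k + l) * (n - 4)" unfolding add_mult_distrib using kn by linarith
    then show ?thesis using main le False n unfolding good_def by simp
  next
    case True
    \<comment> \<open>Missing columns also raise the gain bound of the border queen by
      \<open>k\<close>. Hence a coincidence of rows saves \<open>n - 4\<close> squares, but a
      coincidence of columns only \<open>n - 5\<close>.\<close>
    have "k + (n - 5) \<le> (k + l) * (n - 4)"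
    proof (cases "l = 0")
      case True
      with \<open>card X3 < 3 \<or> _\<close> have "1 \<le> k" using cX by (auto simp: k_def l_def)
      then have "1 * (n - 5) \<le> k * (n - 5)" by (intro mult_le_mono1)
      moreover have "k * (n - 4) = k + k * (n - 5)"
        using n mult_Suc_right[of k "n - 5"] by (simp add: Suc_diff_le[symmetric] eval_nat_numeral)
      ultimately show ?thesis using True by simp
    next
      case False
      then have "1 * (n - 4) \<le> l * (n - 4)" by (intro mult_le_mono) auto
      then show ?thesis unfolding add_mult_distrib using kn by linarith
    qed
    then show ?thesis using main le True n unfolding good_def by simp
  qed
qed

text \<open>At most four queens, rather than exactly four, so that images of configurations stay
  admissible without any injectivity argument.\<close>

definition bounded :: "nat \<Rightarrow> bool" where
  "bounded n \<longleftrightarrow> (\<forall>C \<subseteq> board n. card C \<le> 4 \<longrightarrow> good n C)"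

definition bad :: "nat \<Rightarrow> (nat \<times> nat) set \<Rightarrow> bool" where
  "bad n C \<longleftrightarrow> C \<subseteq> board n \<and> card C \<le> 4 \<and> \<not> good n C"

definition ofs :: "nat \<times> nat \<Rightarrow> int" where
  "ofs q = int (fst q) - int (snd q)"

lemma finite_bad: "bad n C \<Longrightarrow> finite C"
  using finite_subset finite_board unfolding bad_def by blast

text \<open>Removing an empty last column and an empty first row from the board loses at most 16
  covered squares: every row, column and antidiagonal meets the removed squares once, and a diagonal
  meets them twice or not at all, depending on the sign of its offset.\<close>

lemma good_Suc:
  assumes bd: "bounded n" and C: "C \<subseteq> board (Suc n)" "card C \<le> 4"
    and free: "\<And>q. q \<in> C \<Longrightarrow> fst q < n \<and> 0 < snd q"
    and D: "card {z \<in> ofs ` C. 0 \<le> z} \<le> 2"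
  shows "good (Suc n) C"
proof -
  have finC: "finite C" using C(1) finite_subset finite_board by blast
  define C' where "C' = (\<lambda>q. (fst q, snd q - 1)) ` C"
  have "C' \<subseteq> board n" using C(1) free by (force simp: C'_def board_def)
  moreover have "card C' \<le> 4" using card_image_le[OF finC] C(2) unfolding C'_def by (rule order_trans)
  ultimately have g: "card (covered n C') + 72 \<le> 16 * n" using bd unfolding bounded_def good_def by blast
  define Z where "Z = {z \<in> ofs ` C. 0 \<le> z}"
  have finZ: "finite Z" using finC by (simp add: Z_def)
  \<comment> \<open>These are the squares where lines of queens meet the removed column
    \<open>n\<close> and row 0: \<open>S1\<close> from columns, \<open>S2\<close> from rows,
    \<open>S3\<close> from antidiagonals, \<open>S4\<close> and \<open>S5\<close> from the two ends
    of a diagonal with offset \<open>z\<close>.\<close>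
  define S1 where "S1 = (\<lambda>q. (fst q, 0::nat)) ` C"
  define S2 where "S2 = (\<lambda>q. (n, snd q)) ` C"
  define S3 where "S3 = (\<lambda>q. if fst q + snd q \<le> n then (fst q + snd q, 0) else (n, fst q + snd q - n)) ` C"
  define S4 where "S4 = (\<lambda>z. (nat z, 0::nat)) ` Z"
  define S5 where "S5 = (\<lambda>z. (n, n - nat z)) ` Z"
  have "covered (Suc n) C \<subseteq> (\<lambda>p. (fst p, Suc (snd p))) ` covered n C' \<union> (S1 \<union> S2 \<union> S3 \<union> S4 \<union> S5)"
  proof
    fix p assume p: "p \<in> covered (Suc n) C"
    obtain x y where xy: "p = (x, y)" by (cases p)
    from p obtain a b where q: "(a, b) \<in> C" and h: "hits (a, b) (x, y)" and lt: "x < Suc n" "y < Suc n"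
      by (auto simp: covered_def board_def xy)
    have ab: "a < n" "0 < b" using free[OF q] by auto
    show "p \<in> (\<lambda>p. (fst p, Suc (snd p))) ` covered n C' \<union> (S1 \<union> S2 \<union> S3 \<union> S4 \<union> S5)"
    proof (cases "x < n \<and> 0 < y")
      case True
      then obtain y' where y': "y = Suc y'" by (cases y) auto
      have "(a, b - 1) \<in> C'" using q by (force simp: C'_def)
      moreover have "hits (a, b - 1) (x, y')" using h ab y' by (auto simp: hits_def)
      ultimately have "(x, y') \<in> covered n C'" using True lt y' by (auto simp: covered_def board_def)
      then show ?thesis by (auto simp: xy y' image_iff intro!: bexI[of _ "(x, y')"])
    next
      case False
      then have edge: "x = n \<or> y = 0" using lt by auto
      consider "x = a" | "y = b" | "x + b = a + y" | "x + y = a + b" using h by (auto simp: hits_def)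
      then show ?thesis
      proof cases
        case 1
        then have "p \<in> S1" using edge ab q by (force simp: S1_def xy)
        then show ?thesis by blast
      next
        case 2
        then have "p \<in> S2" using edge ab q by (force simp: S2_def xy)
        then show ?thesis by blast
      next
        case 3
        then have ba: "b \<le> a" using edge lt by auto
        then have "ofs (a, b) \<in> Z" using imageI[OF q, of ofs] by (simp add: Z_def) (simp add: ofs_def)
        moreover have "nat (ofs (a, b)) = a - b" by (simp add: ofs_def nat_diff_distrib')
        moreover have "p = (a - b, 0) \<or> p = (n, n - (a - b))" using 3 edge ba by (auto simp: xy)
        ultimately have "p \<in> S4 \<union> S5" unfolding S4_def S5_def by (metis UnCI image_eqI)
        then show ?thesis by blast
      next
        case 4
        then have "p = (if a + b \<le> n then (a + b, 0) else (n, a + b - n))" using edge lt by (auto simp: xy)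
        then have "p \<in> S3" unfolding S3_def using q by (intro image_eqI[of _ _ "(a, b)"]) simp_all
        then show ?thesis by blast
      qed
    qed
  qed
  then have "card (covered (Suc n) C)
      \<le> card ((\<lambda>p. (fst p, Suc (snd p))) ` covered n C' \<union> (S1 \<union> S2 \<union> S3 \<union> S4 \<union> S5))"
    by (rule card_mono[rotated]) (auto simp: S1_def S2_def S3_def S4_def S5_def finC finZ)
  also have "\<dots> \<le> card ((\<lambda>p. (fst p, Suc (snd p))) ` covered n C')
      + (card S1 + card S2 + card S3 + card S4 + card S5)"
    by (meson card_Un_le order_trans add_le_mono le_refl)
  also have "\<dots> \<le> card (covered n C') + (4 + 4 + 4 + 2 + 2)"
  proof (intro add_le_mono)
    show "card ((\<lambda>p. (fst p, Suc (snd p))) ` covered n C') \<le> card (covered n C')"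
      by (rule card_image_le) simp
    show "card S1 \<le> 4" "card S2 \<le> 4" "card S3 \<le> 4"
      unfolding S1_def S2_def S3_def using card_image_le[OF finC] C(2) by (meson order_trans)+
    show "card S4 \<le> 2" "card S5 \<le> 2"
      unfolding S4_def S5_def using card_image_le[OF finZ] D Z_def by (metis order_trans)+
  qed
  finally show ?thesis using g unfolding good_def by simp
qed

section \<open>Symmetries of the board\<close>

definition flip :: "nat \<Rightarrow> nat \<times> nat \<Rightarrow> nat \<times> nat" where
  "flip n q = (n - 1 - fst q, snd q)"

text \<open>An involution of the board that preserves \<open>hits\<close> maps covered squares to
  covered squares in both directions, so it permutes the board compatibly with the cover.\<close>

lemma good_symmetric:
  assumes C: "C \<subseteq> board n" and f: "\<And>q. q \<in> board n \<Longrightarrow> f q \<in> board n \<and> f (f q) = q"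
    and h: "\<And>p q. p \<in> board n \<Longrightarrow> q \<in> board n \<Longrightarrow> hits (f q) (f p) = hits q p"
  shows "good n (f ` C) = good n C"
proof -
  have "covered n (f ` C) = f ` covered n C"
  proof (intro equalityI subsetI)
    fix p assume "p \<in> covered n (f ` C)"
    then obtain q where q: "q \<in> C" "hits (f q) p" and p: "p \<in> board n" by (auto simp: covered_def)
    then have "hits q (f p)" using h[of "f p" q] f C by (metis subsetD)
    then have "f p \<in> covered n C" using q p f by (auto simp: covered_def)
    then show "p \<in> f ` covered n C" using f[OF p] by (metis image_eqI)
  next
    fix p assume "p \<in> f ` covered n C"
    then obtain p' q where p': "p = f p'" "p' \<in> board n" and q: "q \<in> C" "hits q p'"
      by (auto simp: covered_def)
    then have "hits (f q) p" "p \<in> board n" using h[of p' q] f C by blast+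
    then show "p \<in> covered n (f ` C)" using q(1) unfolding covered_def by blast
  qed
  moreover have "inj_on f (covered n C)"
  proof (rule inj_onI)
    fix x y assume xy: "x \<in> covered n C" "y \<in> covered n C" and eq: "f x = f y"
    have "f (f x) = x" using f xy(1) unfolding covered_def by blast
    moreover have "f (f y) = y" using f xy(2) unfolding covered_def by blast
    ultimately show "x = y" using eq by metis
  qed
  ultimately show ?thesis by (simp add: good_def card_image)
qed

lemma bad_symmetric:
  assumes "bad n C" and f: "\<And>q. q \<in> board n \<Longrightarrow> f q \<in> board n \<and> f (f q) = q"
    and h: "\<And>p q. p \<in> board n \<Longrightarrow> q \<in> board n \<Longrightarrow> hits (f q) (f p) = hits q p"
  shows "bad n (f ` C)"
proof -
  have C: "C \<subseteq> board n" using assms(1) by (simp add: bad_def)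
  have "card (f ` C) \<le> 4" using card_image_le[OF finite_bad[OF assms(1)], of f] assms(1) by (simp add: bad_def)
  then show ?thesis using good_symmetric[OF C f h] assms(1) C f by (auto simp: bad_def)
qed

lemma bad_flip: "bad n C \<Longrightarrow> bad n (flip n ` C)"
proof (erule bad_symmetric)
  fix p q assume "p \<in> board n" "q \<in> board n"
  then have "fst p < n" "fst q < n" by (auto simp: board_def)
  then show "hits (flip n q) (flip n p) = hits q p"
    unfolding hits_def flip_def fst_conv snd_conv by linarith
qed (auto simp: flip_def board_def)

lemma bad_swap: "bad n C \<Longrightarrow> bad n (prod.swap ` C)"
  by (rule bad_symmetric) (auto simp: board_def hits_def)

section \<open>Certificates evaluated by rewriting\<close>

text \<open>
  The searches run in the simplifier, so all data are kept small and unary: a subset of \<open>{..<n}\<close> is the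
  list of its complement (\<open>Free\<close> for a line without queen), and counting is done by draining a counter \<open>k\<close>,
  which becomes \<open>0\<close> exactly when \<open>k\<close> or more elements have been found. Lazy case distinctions are
  functions that match on an already evaluated first argument, because \<open>simp\<close> would evaluate both
  branches of an \<open>if\<close>. Wherever \<open>Y\<close> and \<open>Y'\<close> occur together, \<open>Y'\<close> is the mirror image of \<open>Y\<close>, which turns
  antidiagonals into diagonals.
\<close>

datatype bits = End | Free bits | Taken bits

fun drain2 :: "bits \<Rightarrow> bits \<Rightarrow> nat \<Rightarrow> nat" where
  "drain2 xs ys 0 = 0"
| "drain2 (Free xs) (Free ys) (Suc k) = drain2 xs ys k"
| "drain2 (Free xs) (Taken ys) (Suc k) = drain2 xs ys (Suc k)"
| "drain2 (Taken xs) (Free ys) (Suc k) = drain2 xs ys (Suc k)"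
| "drain2 (Taken xs) (Taken ys) (Suc k) = drain2 xs ys (Suc k)"
| "drain2 End ys (Suc k) = Suc k"
| "drain2 (Free xs) End (Suc k) = Suc k"
| "drain2 (Taken xs) End (Suc k) = Suc k"

text \<open>Stripping \<open>a\<close> and \<open>b\<close> together and then skipping the surplus
  on the longer side aligns the two lists: afterwards equal positions are the squares of the
  diagonal through \<open>(a, b)\<close>.\<close>

fun drain_line :: "nat \<Rightarrow> nat \<Rightarrow> bits \<Rightarrow> bits \<Rightarrow> nat \<Rightarrow> nat" where
  "drain_line (Suc a) (Suc b) xs ys k = drain_line a b xs ys k"
| "drain_line (Suc a) 0 (Free xs) ys k = drain_line a 0 xs ys k"
| "drain_line (Suc a) 0 (Taken xs) ys k = drain_line a 0 xs ys k"
| "drain_line 0 (Suc b) xs (Free ys) k = drain_line 0 b xs ys k"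
| "drain_line 0 (Suc b) xs (Taken ys) k = drain_line 0 b xs ys k"
| "drain_line 0 0 xs ys k = drain2 xs ys k"
| "drain_line (Suc a) 0 End ys k = k"
| "drain_line 0 (Suc b) xs End k = k"

fun punch :: "nat \<Rightarrow> bits \<Rightarrow> bits" where
  "punch 0 (Free xs) = Taken xs"
| "punch 0 (Taken xs) = Taken xs"
| "punch (Suc i) (Free xs) = Free (punch i xs)"
| "punch (Suc i) (Taken xs) = Taken (punch i xs)"
| "punch i End = End"

fun drain3 :: "bits \<Rightarrow> bits \<Rightarrow> bits \<Rightarrow> nat \<Rightarrow> nat" where
  "drain3 xs ys zs 0 = 0"
| "drain3 (Free xs) (Free ys) (Free zs) (Suc k) = drain3 xs ys zs k"
| "drain3 (Free xs) (Free ys) (Taken zs) (Suc k) = drain3 xs ys zs (Suc k)"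
| "drain3 (Free xs) (Taken ys) (Free zs) (Suc k) = drain3 xs ys zs (Suc k)"
| "drain3 (Free xs) (Taken ys) (Taken zs) (Suc k) = drain3 xs ys zs (Suc k)"
| "drain3 (Taken xs) (Free ys) (Free zs) (Suc k) = drain3 xs ys zs (Suc k)"
| "drain3 (Taken xs) (Free ys) (Taken zs) (Suc k) = drain3 xs ys zs (Suc k)"
| "drain3 (Taken xs) (Taken ys) (Free zs) (Suc k) = drain3 xs ys zs (Suc k)"
| "drain3 (Taken xs) (Taken ys) (Taken zs) (Suc k) = drain3 xs ys zs (Suc k)"
| "drain3 End ys zs (Suc k) = Suc k"
| "drain3 (Free xs) End zs (Suc k) = Suc k"
| "drain3 (Taken xs) End zs (Suc k) = Suc k"
| "drain3 (Free xs) (Free ys) End (Suc k) = Suc k"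
| "drain3 (Free xs) (Taken ys) End (Suc k) = Suc k"
| "drain3 (Taken xs) (Free ys) End (Suc k) = Suc k"
| "drain3 (Taken xs) (Taken ys) End (Suc k) = Suc k"

primrec tail :: "bits \<Rightarrow> bits" where
  "tail End = End"
| "tail (Free xs) = xs"
| "tail (Taken xs) = xs"

text \<open>Diagonals carry the index \<open>n - 1 - x + y\<close>, which falls as \<open>x\<close>
  grows, so the tails needed by successive columns are prepared in reverse order. Antidiagonals
  carry the index \<open>x + y\<close> and are advanced by \<open>tail\<close> column by
  column.\<close>

primrec rev_tails :: "bits \<Rightarrow> bits \<Rightarrow> bits list \<Rightarrow> bits list" where
  "rev_tails End ys acc = acc"
| "rev_tails (Free xs) ys acc = rev_tails xs (tail ys) (ys # acc)"
| "rev_tails (Taken xs) ys acc = rev_tails xs (tail ys) (ys # acc)"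

fun drain_cols :: "bits \<Rightarrow> bits list \<Rightarrow> bits \<Rightarrow> bits \<Rightarrow> nat \<Rightarrow> nat" where
  "drain_cols (Free xs) (d # ds) A Y k = drain_cols xs ds (tail A) Y (drain3 Y d A k)"
| "drain_cols (Taken xs) (d # ds) A Y k = drain_cols xs ds (tail A) Y k"
| "drain_cols End ds A Y k = k"
| "drain_cols (Free xs) [] A Y k = k"
| "drain_cols (Taken xs) [] A Y k = k"

definition many_free :: "nat \<Rightarrow> bits \<Rightarrow> bits \<Rightarrow> bits \<Rightarrow> bits \<Rightarrow> bool" where
  "many_free k X Y D A \<longleftrightarrow> drain_cols X (rev_tails X D []) A Y k = 0"

primrec trues :: "nat \<Rightarrow> bits" where
  "trues 0 = End"
| "trues (Suc j) = Free (trues j)"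

section \<open>Enumeration of three queens next to a border queen\<close>

datatype cell = Cell nat nat nat nat nat nat

text \<open>The arguments \<open>a'\<close>, \<open>b'\<close> are the distances to the far borders,
  so \<open>a + a' - 3\<close> is \<open>n - 4\<close>. The last component is the loss
  \<open>n - 4 - 2 * margin\<close>, by which the gain bound \<open>n - 4 + 2 * margin\<close> falls
  short of \<open>2 n - 8\<close>. The fifth is the truncated offset \<open>a - b\<close>, which is
  0 above the main diagonal.\<close>

definition mk_cell :: "nat \<Rightarrow> nat \<Rightarrow> nat \<Rightarrow> nat \<Rightarrow> cell" where
  "mk_cell a b a' b' = Cell a b a' b' (a - b)
     (a + a' - Suc (Suc (Suc 0)) - (min (min a a') (min b b') + min (min a a') (min b b')))"

fun drain_gains :: "cell \<Rightarrow> cell \<Rightarrow> cell \<Rightarrow> bits \<Rightarrow> bits \<Rightarrow> bits \<Rightarrow> nat \<Rightarrow> nat" where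
  "drain_gains (Cell a1 b1 _ b1' _ _) (Cell a2 b2 _ b2' _ _) (Cell a3 b3 _ b3' _ _) X Y Y' k =
    drain_line a1 b1 X Y (drain_line a1 b1' X Y' (drain_line a2 b2 X Y (drain_line a2 b2' X Y'
      (drain_line a3 b3 X Y (drain_line a3 b3' X Y' k)))))"

primrec holes :: "bits \<Rightarrow> nat" where
  "holes End = 0" | "holes (Free xs) = holes xs" | "holes (Taken xs) = Suc (holes xs)"

text \<open>The sum of the last two arguments stays equal to \<open>n\<close>. At column
  \<open>a\<close> therefore \<open>a' = n - 1 - a\<close>, and \<open>a' + b\<close> is the
  diagonal index of the queen \<open>(a, b)\<close>.\<close>

fun all_free :: "nat \<Rightarrow> nat \<Rightarrow> bits \<Rightarrow> bits \<Rightarrow> bits \<Rightarrow> bits \<Rightarrow> nat \<Rightarrow> nat \<Rightarrow> bool" where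
  "all_free N b X Y D A a' 0 = True"
| "all_free N b X Y D A a' (Suc a) =
    (many_free N (punch a X) Y (punch (a' + b) D) (punch (a + b) A) \<and> all_free N b X Y D A (Suc a') a)"

fun free4 :: "nat \<Rightarrow> nat \<Rightarrow> nat \<Rightarrow> nat \<Rightarrow> cell \<Rightarrow> cell \<Rightarrow> cell \<Rightarrow> bits \<Rightarrow> bits \<Rightarrow> bool" where
  "free4 N b a' a (Cell a1 b1 a1' b1' _ _) (Cell a2 b2 a2' b2' _ _) (Cell a3 b3 a3' b3' _ _) X Y =
    all_free N b X Y (punch (a1' + b1) (punch (a2' + b2) (punch (a3' + b3) (trues (a1 + a1' + Suc (b1 + b1'))))))
      (punch (a1 + b1) (punch (a2 + b2) (punch (a3 + b3) (trues (a1 + a1' + Suc (b1 + b1')))))) a' a"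

text \<open>In \<open>Param K K' N b a' a\<close>, three queens pass if their gains drain neither \<open>K\<close> nor, when they share
  a line with each other or with row \<open>b\<close>, \<open>K'\<close>. Otherwise each fourth queen in row \<open>b\<close> and a column below
  \<open>a\<close> must leave \<open>N\<close> squares free, where \<open>N = (n - 8)^2 + 8 = n^2 - (16 n - 72)\<close>; \<open>a' = n - a\<close>.\<close>

datatype param = Param nat nat nat nat nat nat

fun check3_slow :: "nat \<Rightarrow> param \<Rightarrow> cell \<Rightarrow> cell \<Rightarrow> cell \<Rightarrow> bits \<Rightarrow> bits \<Rightarrow> bool" where
  "check3_slow (Suc j) P p q r X Y = True"
| "check3_slow 0 (Param K K' N b a' a) p q r X Y = free4 N b a' a p q r X Y"

fun check3_shared :: "bool \<Rightarrow> bool \<Rightarrow> param \<Rightarrow> cell \<Rightarrow> cell \<Rightarrow> cell \<Rightarrow> bits \<Rightarrow> bits \<Rightarrow> bits \<Rightarrow> bool" where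
  "check3_shared False False P p q r X Y Y' = check3_slow 0 P p q r X Y"
| "check3_shared True s (Param K K' N b a' a) p q r X Y Y' =
    check3_slow (drain_gains p q r X Y Y' K') (Param K K' N b a' a) p q r X Y"
| "check3_shared False True (Param K K' N b a' a) p q r X Y Y' =
    check3_slow (drain_gains p q r X Y Y' K') (Param K K' N b a' a) p q r X Y"

fun check3_more :: "nat \<Rightarrow> param \<Rightarrow> cell \<Rightarrow> cell \<Rightarrow> cell \<Rightarrow> bits \<Rightarrow> bits \<Rightarrow> bits \<Rightarrow> bool" where
  "check3_more (Suc j) P p q r X Y Y' = True"
| "check3_more 0 P p q r X Y Y' =
    check3_shared (holes X \<le> Suc (Suc 0)) (holes Y \<le> Suc (Suc (Suc 0))) P p q r X Y Y'"

fun check3 :: "param \<Rightarrow> cell \<Rightarrow> cell \<Rightarrow> cell \<Rightarrow> bits \<Rightarrow> bits \<Rightarrow> bits \<Rightarrow> bool" where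
  "check3 (Param K K' N b a' a) p q r X Y Y' =
    check3_more (drain_gains p q r X Y Y' K) (Param K K' N b a' a) p q r X Y Y'"

fun check3_if :: "bool \<Rightarrow> bool \<Rightarrow> param \<Rightarrow> cell \<Rightarrow> cell \<Rightarrow> cell \<Rightarrow> bits \<Rightarrow> bits \<Rightarrow> bits \<Rightarrow> bool" where
  "check3_if True False P p q (Cell a b a' b' d m) X Y Y' =
     check3 P p q (Cell a b a' b' d m) (punch a X) (punch b Y) (punch b' Y')"
| "check3_if True True P p q r X Y Y' = True"
| "check3_if False s P p q r X Y Y' = True"

text \<open>\<open>k\<close> is the rest of the loss budget and \<open>e\<close> the diagonal of
  \<open>q\<close>. In the loops for a top queen, the list has already been purged of the diagonal
  of \<open>p\<close> by \<open>near\<close>.\<close>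

fun loop3 :: "param \<Rightarrow> nat \<Rightarrow> nat \<Rightarrow> cell \<Rightarrow> cell \<Rightarrow> cell list \<Rightarrow> bits \<Rightarrow> bits \<Rightarrow> bits \<Rightarrow> bool" where
  "loop3 P k e p q [] X Y Y' = True"
| "loop3 P k e p q (Cell a b a' b' d m # l) X Y Y' =
    (check3_if (m \<le> k) (d = e) P p q (Cell a b a' b' d m) X Y Y' \<and> loop3 P k e p q l X Y Y')"

fun cons_if :: "bool \<Rightarrow> bool \<Rightarrow> cell \<Rightarrow> cell list \<Rightarrow> cell list" where
  "cons_if True False c l = c # l"
| "cons_if True True c l = l"
| "cons_if False s c l = l"

fun near :: "nat \<Rightarrow> nat \<Rightarrow> cell list \<Rightarrow> cell list" where
  "near k e [] = []"
| "near k e (Cell a b a' b' d m # l) = cons_if (m \<le> k) (d = e) (Cell a b a' b' d m) (near k e l)"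

fun loop2 :: "param \<Rightarrow> nat \<Rightarrow> cell \<Rightarrow> cell list \<Rightarrow> bits \<Rightarrow> bits \<Rightarrow> bits \<Rightarrow> bool" where
  "loop2 P k p [] X Y Y' = True"
| "loop2 P k p (Cell a b a' b' d m # l) X Y Y' =
    (loop3 P (k - m) d p (Cell a b a' b' d m) l (punch a X) (punch b Y) (punch b' Y') \<and> loop2 P k p l X Y Y')"

fun loop1 :: "param \<Rightarrow> nat \<Rightarrow> cell list \<Rightarrow> bits \<Rightarrow> bits \<Rightarrow> bits \<Rightarrow> bool" where
  "loop1 P k [] X Y Y' = True"
| "loop1 P k (Cell a b a' b' d m # l) X Y Y' =
    (loop2 P (k - m) (Cell a b a' b' d m) (near (k - m) d l) (punch a X) (punch b Y) (punch b' Y')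
     \<and> loop1 P k l X Y Y')"

primrec upfrom :: "nat \<Rightarrow> nat \<Rightarrow> nat list" where
  "upfrom i 0 = []"
| "upfrom i (Suc k) = i # upfrom (Suc i) k"

fun keep_near :: "nat \<Rightarrow> cell list \<Rightarrow> cell list" where
  "keep_near k [] = []"
| "keep_near k (Cell a b a' b' d m # l) = cons_if (m \<le> k) False (Cell a b a' b' d m) (keep_near k l)"

text \<open>The queen on the last row has loss \<open>n - 4\<close>, and a total loss of 24 is
  enough, so only trios of total loss at most \<open>27 - n\<close> are searched. The cells keep
  clear of the first row and last column and have nonnegative offset, whence the ranges
  \<open>1..n - 2\<close> for columns and \<open>1..a\<close> for rows.\<close>

definition check_top :: "nat \<Rightarrow> bool" where
  "check_top n = loop1
    (Param (n + (n + (n + (n + (n + (n + n))))) - 51) (n + (n + (n + (n + (n + (n + (n + n)))))) - 56)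
       ((n - 8) * (n - 8) + 8) (n - 1) (Suc 0) (n - 1)) (27 - n)
    (concat (map (\<lambda>a. keep_near (27 - n) (map (\<lambda>b. mk_cell a b (n - 1 - a) (n - 1 - b)) (upfrom 1 a))) (upfrom 1 (n - 2))))
    (trues n) (punch (n - 1) (trues n)) (punch 0 (trues n))"

text \<open>Queens of the last row have truncated offset 0 and loss at most \<open>n\<close>;
  passing \<open>n\<close> as budget and \<open>Suc 0\<close> as forbidden diagonal switches off
  both filters of \<open>loop3\<close> for them.\<close>

fun edge_loop2 :: "param \<Rightarrow> nat \<Rightarrow> cell list \<Rightarrow> cell \<Rightarrow> cell list \<Rightarrow> bits \<Rightarrow> bits \<Rightarrow> bits \<Rightarrow> bool" where
  "edge_loop2 P n ts p [] X Y Y' = True"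
| "edge_loop2 P n ts p (Cell a b a' b' d m # l) X Y Y' =
    (loop3 P n (Suc 0) p (Cell a b a' b' d m) ts (punch a X) (punch b Y) (punch b' Y') \<and> edge_loop2 P n ts p l X Y Y')"

text \<open>The current cell stays in the list of its partners: a configuration of fewer than four
  queens leads to two equal choices.\<close>

fun edge_loop1 :: "param \<Rightarrow> nat \<Rightarrow> cell list \<Rightarrow> nat \<Rightarrow> cell list \<Rightarrow> bits \<Rightarrow> bits \<Rightarrow> bits \<Rightarrow> bool" where
  "edge_loop1 P n ts k [] X Y Y' = True"
| "edge_loop1 P n ts k (Cell a b a' b' d m # l) X Y Y' =
    (edge_loop2 P n ts (Cell a b a' b' d m) (keep_near (k - m) (Cell a b a' b' d m # l)) (punch a X) (punch b Y) (punch b' Y')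
     \<and> edge_loop1 P n ts k l X Y Y')"

text \<open>Two border queens contribute \<open>2 (n - 4)\<close> to the required loss of 24, so at
  most \<open>31 - 2 n\<close> is left for the other two.\<close>

definition check_edges :: "nat \<Rightarrow> bool" where
  "check_edges n = edge_loop1
    (Param (n + (n + (n + (n + (n + (n + n))))) - 51) (n + (n + (n + (n + (n + (n + (n + n)))))) - 56)
       ((n - 8) * (n - 8) + 8) 0 0 n) n (map (\<lambda>a. mk_cell a (n - 1) (n - 1 - a) 0) (upfrom 0 n)) (31 - (n + n))
    (concat (map (\<lambda>a. keep_near (31 - (n + n)) (map (\<lambda>b. mk_cell a b (n - 1 - a) (n - 1 - b)) (upfrom 0 n))) (upfrom 0 n)))
    (trues n) (punch 0 (trues n)) (punch (n - 1) (trues n))"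

section \<open>Branch and bound on the board of size 11\<close>

datatype pos = Pos nat nat
datatype info = Info bits bits "pos list"
text \<open>An entry is a candidate queen \<open>(x, y)\<close> with mirrored coordinates, preceded
  by its deficit, the amount by which its gain stays below \<open>B\<close>. A slot holds the
  candidates for one queen, their least deficit, and the sum of the least deficits of all later
  slots; the last number prunes the search.\<close>

datatype entry = Entry nat nat nat nat nat
datatype slot = Slot "entry list" nat nat

primrec positions :: "nat \<Rightarrow> nat \<Rightarrow> bits \<Rightarrow> pos list" where
  "positions i j End = []"
| "positions i j (Free xs) = positions (Suc i) (j - Suc 0) xs"
| "positions i j (Taken xs) = Pos i j # positions (Suc i) (j - Suc 0) xs"

primrec reverse :: "bits \<Rightarrow> bits \<Rightarrow> bits" where
  "reverse End acc = acc"
| "reverse (Free xs) acc = reverse xs (Free acc)"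
| "reverse (Taken xs) acc = reverse xs (Taken acc)"

text \<open>Keeps one pattern out of each mirror pair; totality of the comparison ensures that a
  pattern or its mirror image survives.\<close>

fun lex_le :: "bits \<Rightarrow> bits \<Rightarrow> bool" where
  "lex_le (Free xs) (Free ys) = lex_le xs ys"
| "lex_le (Taken xs) (Taken ys) = lex_le xs ys"
| "lex_le (Taken xs) (Free ys) = True"
| "lex_le (Free xs) (Taken ys) = False"
| "lex_le End ys = True"
| "lex_le (Free xs) End = False"
| "lex_le (Taken xs) End = False"

fun patterns :: "nat \<Rightarrow> nat \<Rightarrow> bits list" where
  "patterns 0 0 = [End]"
| "patterns 0 (Suc k) = []"
| "patterns (Suc n) 0 = map Free (patterns n 0)"
| "patterns (Suc n) (Suc k) = map Taken (patterns n k) @ map Free (patterns n (Suc k))"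

fun add_info :: "bool \<Rightarrow> nat \<Rightarrow> bits \<Rightarrow> info list \<Rightarrow> info list" where
  "add_info True j m l = Info m (reverse m End) (positions 0 j m) # l"
| "add_info False j m l = l"

primrec infos :: "nat \<Rightarrow> bits list \<Rightarrow> info list" where
  "infos j [] = []"
| "infos j (m # ms) = add_info (lex_le m (reverse m End)) j m (infos j ms)"

fun deficit :: "nat \<Rightarrow> pos \<Rightarrow> pos \<Rightarrow> bits \<Rightarrow> bits \<Rightarrow> bits \<Rightarrow> nat" where
  "deficit B (Pos x x') (Pos y y') X Y Y' = drain_line x y X Y (drain_line x y' X Y' B)"

primrec col_min :: "nat \<Rightarrow> pos \<Rightarrow> pos list \<Rightarrow> bits \<Rightarrow> bits \<Rightarrow> bits \<Rightarrow> nat" where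
  "col_min B x [] X Y Y' = B"
| "col_min B x (y # ys) X Y Y' = min (deficit B x y X Y Y') (col_min B x ys X Y Y')"

primrec col_mins :: "nat \<Rightarrow> pos list \<Rightarrow> pos list \<Rightarrow> bits \<Rightarrow> bits \<Rightarrow> bits \<Rightarrow> nat list" where
  "col_mins B [] ys X Y Y' = []"
| "col_mins B (x # xs) ys X Y Y' = col_min B x ys X Y Y' # col_mins B xs ys X Y Y'"

primrec minl :: "nat \<Rightarrow> nat list \<Rightarrow> nat" where
  "minl B [] = B"
| "minl B (x # xs) = min x (minl B xs)"

text \<open>Each occupied column contributes one queen of its own. If there are fewer than four
  columns, the remaining queens may stand in any of them, and the default \<open>y\<close> describes
  this choice.\<close>

fun pad :: "nat \<Rightarrow> 'a list \<Rightarrow> 'a \<Rightarrow> 'a list" where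
  "pad (Suc n) (x # xs) y = x # pad n xs y"
| "pad (Suc n) [] y = y # pad n [] y"
| "pad 0 xs y = xs"

primrec sub_list :: "nat \<Rightarrow> nat list \<Rightarrow> nat" where
  "sub_list k [] = k"
| "sub_list k (x # xs) = sub_list (k - x) xs"

fun entry_of :: "nat \<Rightarrow> pos \<Rightarrow> pos \<Rightarrow> bits \<Rightarrow> bits \<Rightarrow> bits \<Rightarrow> entry" where
  "entry_of B (Pos x x') (Pos y y') X Y Y' = Entry (deficit B (Pos x x') (Pos y y') X Y Y') x x' y y'"

primrec col_entries :: "nat \<Rightarrow> pos \<Rightarrow> pos list \<Rightarrow> bits \<Rightarrow> bits \<Rightarrow> bits \<Rightarrow> entry list" where
  "col_entries B x [] X Y Y' = []"
| "col_entries B x (y # ys) X Y Y' = entry_of B x y X Y Y' # col_entries B x ys X Y Y'"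

primrec all_entries :: "nat \<Rightarrow> pos list \<Rightarrow> pos list \<Rightarrow> bits \<Rightarrow> bits \<Rightarrow> bits \<Rightarrow> entry list list" where
  "all_entries B [] ys X Y Y' = []"
| "all_entries B (x # xs) ys X Y Y' = col_entries B x ys X Y Y' # all_entries B xs ys X Y Y'"

fun min_entry :: "nat \<Rightarrow> entry list \<Rightarrow> nat" where
  "min_entry B [] = B"
| "min_entry B (Entry d x x' y y' # es) = min d (min_entry B es)"

fun cons_slot :: "entry list \<Rightarrow> nat \<Rightarrow> slot list \<Rightarrow> slot list" where
  "cons_slot es m [] = [Slot es m 0]"
| "cons_slot es m (Slot es' m' r' # l) = Slot es m (m' + r') # Slot es' m' r' # l"

primrec slots :: "nat \<Rightarrow> entry list list \<Rightarrow> slot list" where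
  "slots B [] = []"
| "slots B (es # l) = cons_slot es (min_entry B es) (slots B l)"

fun cons_if_not :: "bool \<Rightarrow> nat \<Rightarrow> nat list \<Rightarrow> nat list" where
  "cons_if_not True z l = l"
| "cons_if_not False z l = z # l"

primrec remove_row :: "nat \<Rightarrow> nat list \<Rightarrow> nat list" where
  "remove_row y [] = []"
| "remove_row y (z # l) = cons_if_not (y = z) z (remove_row y l)"

fun len_le :: "nat list \<Rightarrow> slot list \<Rightarrow> bool" where
  "len_le [] ss = True"
| "len_le (y # ys) [] = False"
| "len_le (y # ys) (s # ss) = len_le ys ss"

fun rows :: "pos list \<Rightarrow> nat list" where
  "rows [] = []"
| "rows (Pos y y' # l) = y # rows l"

text \<open>A branch is closed when the deficit spent together with the least deficit of the
  remaining slots reaches \<open>k\<close>, or when more rows in \<open>ys\<close> wait for a queen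
  than slots are left. A complete choice must leave \<open>17 = 121 - 104\<close> squares
  free.\<close>

function (sequential) search :: "bits \<Rightarrow> bits \<Rightarrow> nat \<Rightarrow> bits \<Rightarrow> bits \<Rightarrow> nat list \<Rightarrow> slot list \<Rightarrow> bool"
  and search_slot :: "bits \<Rightarrow> bits \<Rightarrow> nat \<Rightarrow> bits \<Rightarrow> bits \<Rightarrow> nat list \<Rightarrow> entry list \<Rightarrow> nat \<Rightarrow> slot list \<Rightarrow> bool"
  and search_if :: "nat \<Rightarrow> bool \<Rightarrow> bits \<Rightarrow> bits \<Rightarrow> nat \<Rightarrow> bits \<Rightarrow> bits \<Rightarrow> nat list \<Rightarrow> slot list \<Rightarrow> bool" where
  "search X Y k D A ys [] = many_free 17 X Y D A"
| "search X Y k D A ys (Slot es m r # ss) = search_slot X Y k D A ys es r ss"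
| "search_slot X Y k D A ys [] r ss = True"
| "search_slot X Y k D A ys (Entry d x x' y y' # es) r ss =
    (search_if (k - d - r) (len_le (remove_row y ys) ss) X Y (k - d) (punch (x' + y) D) (punch (x + y) A) (remove_row y ys) ss
     \<and> search_slot X Y k D A ys es r ss)"
| "search_if 0 b X Y k D A ys ss = True"
| "search_if (Suc j) False X Y k D A ys ss = True"
| "search_if (Suc j) True X Y k D A ys ss = search X Y k D A ys ss"
  by pat_completeness auto
termination
  by (relation "measure (\<lambda>p. case p of
      Inl (X, Y, k, D, A, ys, ss) \<Rightarrow> sum_list (map (\<lambda>s. case s of Slot es m r \<Rightarrow> 3 + 2 * length es) ss)
    | Inr (Inl (X, Y, k, D, A, ys, es, r, ss)) \<Rightarrow> 2 + 2 * length es + sum_list (map (\<lambda>s. case s of Slot es m r \<Rightarrow> 3 + 2 * length es) ss)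
    | Inr (Inr (j, b, X, Y, k, D, A, ys, ss)) \<Rightarrow> 1 + sum_list (map (\<lambda>s. case s of Slot es m r \<Rightarrow> 3 + 2 * length es) ss))") auto

definition four :: nat where "four = Suc (Suc (Suc (Suc 0)))"

fun pair_search :: "nat \<Rightarrow> nat \<Rightarrow> nat \<Rightarrow> bits \<Rightarrow> bits \<Rightarrow> pos list \<Rightarrow> entry list list \<Rightarrow> bool" where
  "pair_search B k w X Y ys ess =
    search X Y k (trues w) (trues w) (rows ys) (slots B (pad four ess (concat ess)))"

fun pair_if :: "nat \<Rightarrow> nat \<Rightarrow> nat \<Rightarrow> nat \<Rightarrow> info \<Rightarrow> info \<Rightarrow> bool" where
  "pair_if 0 B k w i j = True"
| "pair_if (Suc l) B k w (Info X X' xs) (Info Y Y' ys) = pair_search B k w X Y ys (all_entries B xs ys X Y Y')"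

text \<open>The sum of the column minima is tried alone; the search is started only if this sum
  stays below \<open>k\<close>.\<close>

fun pair_mins :: "nat list \<Rightarrow> nat \<Rightarrow> nat \<Rightarrow> nat \<Rightarrow> info \<Rightarrow> info \<Rightarrow> bool" where
  "pair_mins ms B k w i j = pair_if (sub_list k (pad four ms (minl B ms))) B k w i j"

fun pair :: "nat \<Rightarrow> nat \<Rightarrow> nat \<Rightarrow> info \<Rightarrow> info \<Rightarrow> bool" where
  "pair B k w (Info X X' xs) (Info Y Y' ys) =
    pair_mins (col_mins B xs ys X Y Y') B k w (Info X X' xs) (Info Y Y' ys)"

primrec pair_all :: "nat \<Rightarrow> nat \<Rightarrow> nat \<Rightarrow> info \<Rightarrow> info list \<Rightarrow> bool" where
  "pair_all B k w i [] = True"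
| "pair_all B k w i (j # js) = (pair B k w i j \<and> pair_all B k w i js)"

text \<open>Transposition exchanges the patterns of columns and rows, so unordered pairs are enough
  when both have the same number of lines.\<close>

primrec pairs_same :: "nat \<Rightarrow> nat \<Rightarrow> nat \<Rightarrow> info list \<Rightarrow> bool" where
  "pairs_same B k w [] = True"
| "pairs_same B k w (i # is) = (pair_all B k w i (i # is) \<and> pairs_same B k w is)"

primrec pairs_diff :: "nat \<Rightarrow> nat \<Rightarrow> nat \<Rightarrow> info list \<Rightarrow> info list \<Rightarrow> bool" where
  "pairs_diff B k w [] js = True"
| "pairs_diff B k w (i # is) js = (pair_all B k w i js \<and> pairs_diff B k w is js)"

lemma Suc_le_0_False: "(Suc k \<le> 0) = False" by simp

lemma eq_self_True: "(x = x) = True" by simp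

lemma True_conj: "(True \<and> P) = P" by simp

lemmas check_simps = drain2.simps drain_line.simps punch.simps drain3.simps tail.simps rev_tails.simps
  drain_cols.simps many_free_def trues.simps mk_cell_def drain_gains.simps holes.simps all_free.simps free4.simps
  check3_slow.simps check3_shared.simps check3_more.simps check3.simps check3_if.simps loop3.simps
  cons_if.simps near.simps loop2.simps loop1.simps keep_near.simps
  diff_Suc_Suc diff_0_eq_0 minus_nat.diff_0 add_Suc add_0 min_Suc_Suc min_0L min_0R Suc_le_mono le0 Suc_le_0_False
  nat.inject Suc_not_Zero Zero_not_Suc eq_self_True True_conj
  mult_Suc mult_0 upfrom.simps list.map concat.simps append.simps diff_Suc_1
  eval_nat_numeral BitM.simps numeral_One One_nat_def check_top_def
  edge_loop2.simps edge_loop1.simps check_edges_def positions.simps reverse.simps lex_le.simps patterns.simps add_info.simps infos.simps deficit.simps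
  col_min.simps col_mins.simps minl.simps pad.simps sub_list.simps entry_of.simps col_entries.simps all_entries.simps
  min_entry.simps cons_slot.simps slots.simps cons_if_not.simps remove_row.simps len_le.simps rows.simps search.simps search_slot.simps search_if.simps
  four_def pair_search.simps pair_if.simps pair_mins.simps pair.simps pair_all.simps pairs_same.simps pairs_diff.simps

section \<open>Correctness of the certificates\<close>

fun free_at :: "bits \<Rightarrow> nat \<Rightarrow> bool" where
  "free_at End i = False"
| "free_at (Free xs) 0 = True"
| "free_at (Taken xs) 0 = False"
| "free_at (Free xs) (Suc i) = free_at xs i"
| "free_at (Taken xs) (Suc i) = free_at xs i"

primrec len :: "bits \<Rightarrow> nat" where
  "len End = 0"
| "len (Free xs) = Suc (len xs)"
| "len (Taken xs) = Suc (len xs)"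

lemma bit_less_len: "free_at xs i \<Longrightarrow> i < len xs"
  by (induction xs i rule: free_at.induct) auto

lemma finite_bit [simp]: "finite {i. free_at xs i}"
  by (rule finite_subset[of _ "{..<len xs}"]) (auto dest: bit_less_len)

lemma finite_bit_conj [simp]: "finite {i. free_at xs i \<and> P i}"
  by (rule finite_subset[OF _ finite_bit[of xs]]) auto

text \<open>Splits a count of indices in the way the recursions split their lists, into head and
  shifted tail.\<close>

lemma card_Collect_Suc:
  assumes "finite {i. P i}"
  shows "card {i. P i} = (if P 0 then 1 else 0) + card {i. P (Suc i)}"
proof -
  have eq: "{i. P i} = (if P 0 then {0} else {}) \<union> Suc ` {i. P (Suc i)}"
  proof (intro set_eqI)
    show "i \<in> {i. P i} \<longleftrightarrow> i \<in> (if P 0 then {0} else {}) \<union> Suc ` {i. P (Suc i)}" for i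
      by (cases i) auto
  qed
  have "finite (Suc ` {i. P (Suc i)})" using assms eq by (metis finite_Un)
  then have "finite {i. P (Suc i)}" by (simp add: finite_image_iff)
  then show ?thesis by (subst eq) (auto simp: card_image card_insert_if)
qed

lemma drain2: "drain2 xs ys k = k - card {i. free_at xs i \<and> free_at ys i}"
  by (induction xs ys k rule: drain2.induct) (simp_all add: card_Collect_Suc)

lemma drain3: "drain3 xs ys zs k = k - card {i. free_at xs i \<and> free_at ys i \<and> free_at zs i}"
  by (induction xs ys zs k rule: drain3.induct) (simp_all add: card_Collect_Suc)

lemma drain_line: "drain_line a b xs ys k = k - card {i. free_at xs (i + (a - b)) \<and> free_at ys (i + (b - a))}"
  by (induction a b xs ys k rule: drain_line.induct) (simp_all add: drain2)

lemma bit_punch: "free_at (punch i xs) j \<longleftrightarrow> free_at xs j \<and> j \<noteq> i"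
proof (induction i xs arbitrary: j rule: punch.induct)
  case (1 xs) then show ?case by (cases j) auto
next
  case (2 xs) then show ?case by (cases j) auto
next
  case (3 i xs) then show ?case by (cases j) auto
next
  case (4 i xs) then show ?case by (cases j) auto
qed auto

lemma len_punch [simp]: "len (punch i xs) = len xs"
  by (induction i xs rule: punch.induct) auto

lemma bit_trues: "free_at (trues n) j \<longleftrightarrow> j < n"
proof (induction n arbitrary: j)
  case (Suc n) then show ?case by (cases j) auto
qed simp

lemma len_trues [simp]: "len (trues n) = n"
  by (induction n) auto

lemma bit_tail: "free_at (tail xs) i = free_at xs (Suc i)"
  by (cases xs) auto

lemma rev_tails_append: "rev_tails xs ys acc = rev_tails xs ys [] @ acc"
proof (induction xs arbitrary: ys acc)
  case (Free xs)
  show ?case by (simp, subst Free, subst (2) Free, simp)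
next
  case (Taken xs)
  show ?case by (simp, subst Taken, subst (2) Taken, simp)
qed simp

lemma length_rev_tails [simp]: "length (rev_tails xs ys acc) = len xs + length acc"
  by (induction xs arbitrary: ys acc) auto

lemma bit_rev_tails: "x < len xs \<Longrightarrow> free_at (rev_tails xs ys [] ! x) i = free_at ys (len xs - 1 - x + i)"
proof (induction xs arbitrary: ys)
  case (Free xs)
  then show ?case by (subst rev_tails.simps, subst rev_tails_append)
    (auto simp: nth_append bit_tail less_Suc_eq Suc_diff_Suc)
next
  case (Taken xs)
  then show ?case by (subst rev_tails.simps, subst rev_tails_append)
    (auto simp: nth_append bit_tail less_Suc_eq Suc_diff_Suc)
qed simp

lemma drain_cols:
  "len xs \<le> length ds \<Longrightarrow> drain_cols xs ds as Y k = k -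
    (\<Sum>x<len xs. if free_at xs x then card {i. free_at Y i \<and> free_at (ds ! x) i \<and> free_at as (x + i)} else 0)"
proof (induction xs ds as Y k rule: drain_cols.induct)
  case (1 xs d ds A Y k)
  then show ?case by (simp add: sum.lessThan_Suc_shift drain3 bit_tail del: sum.lessThan_Suc cong: if_cong)
next
  case (2 xs d ds A Y k)
  then show ?case by (simp add: sum.lessThan_Suc_shift drain3 bit_tail del: sum.lessThan_Suc cong: if_cong)
qed auto

lemma many_free:
  assumes "many_free N X Y D A"
  shows "N \<le> card {(x, y). free_at X x \<and> free_at Y y \<and> free_at D (len X - 1 - x + y) \<and> free_at A (x + y)}"
proof -
  have "N \<le> (\<Sum>x<len X. if free_at X x then
      card {i. free_at Y i \<and> free_at (rev_tails X D [] ! x) i \<and> free_at A (x + i)} else 0)"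
    using assms unfolding many_free_def by (subst (asm) drain_cols) auto
  also have "\<dots> = (\<Sum>x<len X. card {i. free_at X x \<and> free_at Y i \<and> free_at D (len X - 1 - x + i) \<and> free_at A (x + i)})"
    by (intro sum.cong) (auto simp: bit_rev_tails)
  also have "\<dots> = card (SIGMA x:{..<len X}. {i. free_at X x \<and> free_at Y i \<and> free_at D (len X - 1 - x + i) \<and> free_at A (x + i)})"
    by (subst card_SigmaI) (auto intro!: finite_subset[OF _ finite_bit[of Y]])
  also have "(SIGMA x:{..<len X}. {i. free_at X x \<and> free_at Y i \<and> free_at D (len X - 1 - x + i) \<and> free_at A (x + i)}) =
    {(x, y). free_at X x \<and> free_at Y y \<and> free_at D (len X - 1 - x + y) \<and> free_at A (x + y)}"
    by (auto dest: bit_less_len)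
  finally show ?thesis .
qed

section \<open>Sets of occupied lines as bit lists\<close>

definition repr :: "nat \<Rightarrow> nat set \<Rightarrow> bits \<Rightarrow> bool" where
  "repr n S xs \<longleftrightarrow> len xs = n \<and> (\<forall>i. free_at xs i \<longleftrightarrow> i < n \<and> i \<notin> S)"

lemma repr_trues: "repr n {} (trues n)"
  by (simp add: repr_def bit_trues)

lemma repr_punch: "repr n S xs \<Longrightarrow> repr n (insert i S) (punch i xs)"
  by (auto simp: repr_def bit_punch)

lemma holes: "repr n S xs \<Longrightarrow> S \<subseteq> {..<n} \<Longrightarrow> holes xs = card S"
proof -
  have "holes xs = card {i. i < len xs \<and> \<not> free_at xs i}"
    by (induction xs) (simp_all add: card_Collect_Suc)
  moreover assume "repr n S xs" "S \<subseteq> {..<n}"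
  then have "{i. i < len xs \<and> \<not> free_at xs i} = S" by (auto simp: repr_def)
  ultimately show "holes xs = card S" by simp
qed

definition mirror :: "nat \<Rightarrow> nat set \<Rightarrow> nat set" where
  "mirror n S = (\<lambda>i. n - 1 - i) ` S"

lemma drain_line_diag:
  assumes "repr n X xs" "repr n Y ys"
  shows "drain_line a b xs ys k = k - diag_free n X Y (a, b)"
proof -
  let ?S = "{i. free_at xs (i + (a - b)) \<and> free_at ys (i + (b - a))}"
  have "(\<lambda>i. i + (a - b)) ` ?S = {x. x < n \<and> x \<notin> X \<and> (\<exists>y<n. y \<notin> Y \<and> x + b = a + y)}"
  proof (intro equalityI subsetI)
    fix x assume "x \<in> {x. x < n \<and> x \<notin> X \<and> (\<exists>y<n. y \<notin> Y \<and> x + b = a + y)}"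
    then obtain y where "x < n" "x \<notin> X" "y < n" "y \<notin> Y" "x + b = a + y" by auto
    then have "free_at xs x" "free_at ys y" and e: "x - (a - b) + (a - b) = x" "x - (a - b) + (b - a) = y"
      using assms unfolding repr_def by auto
    then have "x - (a - b) \<in> ?S" by simp
    then show "x \<in> (\<lambda>i. i + (a - b)) ` ?S" using e(1) by (intro image_eqI[of _ _ "x - (a - b)"]) simp_all
  next
    fix x assume "x \<in> (\<lambda>i. i + (a - b)) ` ?S"
    then obtain i where i: "x = i + (a - b)" "free_at xs (i + (a - b))" "free_at ys (i + (b - a))" by auto
    then have "x < n" "x \<notin> X" "i + (b - a) < n" "i + (b - a) \<notin> Y" using assms by (auto simp: repr_def)
    moreover have "x + b = a + (i + (b - a))" using i(1) by linarith
    ultimately show "x \<in> {x. x < n \<and> x \<notin> X \<and> (\<exists>y<n. y \<notin> Y \<and> x + b = a + y)}" by blast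
  qed
  moreover have "card ((\<lambda>i. i + (a - b)) ` ?S) = card ?S" by (rule card_image) (simp add: inj_on_def)
  ultimately have "card ?S = diag_free n X Y (a, b)" by (simp only: diag_free_def fst_conv snd_conv)
  then show ?thesis by (simp add: drain_line)
qed

lemma diag_free_mirror:
  assumes "b < n" "Y \<subseteq> {..<n}"
  shows "diag_free n X (mirror n Y) (a, n - 1 - b) = anti_free n X Y (a, b)"
proof -
  have "(\<exists>y<n. y \<notin> mirror n Y \<and> x + (n - 1 - b) = a + y) \<longleftrightarrow> (\<exists>y<n. y \<notin> Y \<and> x + y = a + b)" for x
  proof
    assume "\<exists>y<n. y \<notin> mirror n Y \<and> x + (n - 1 - b) = a + y"
    then obtain y where y: "y < n" "y \<notin> mirror n Y" "x + (n - 1 - b) = a + y" by blast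
    have "n - 1 - y \<notin> Y" using y(1,2) by (force simp: mirror_def)
    moreover have "x + (n - 1 - y) = a + b" "n - 1 - y < n" using y assms by linarith+
    ultimately show "\<exists>y<n. y \<notin> Y \<and> x + y = a + b" by blast
  next
    assume "\<exists>y<n. y \<notin> Y \<and> x + y = a + b"
    then obtain y where y: "y < n" "y \<notin> Y" "x + y = a + b" by blast
    have "n - 1 - y \<notin> mirror n Y"
    proof
      assume "n - 1 - y \<in> mirror n Y"
      then obtain z where "z \<in> Y" "n - 1 - y = n - 1 - z" by (auto simp: mirror_def)
      moreover from this have "z < n" using assms(2) by blast
      ultimately have "y = z" using y(1) by linarith
      then show False using \<open>z \<in> Y\<close> y(2) by simp
    qed
    moreover have "x + (n - 1 - b) = a + (n - 1 - y)" "n - 1 - y < n" using y assms by linarith+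
    ultimately show "\<exists>y<n. y \<notin> mirror n Y \<and> x + (n - 1 - b) = a + y" by blast
  qed
  then show ?thesis unfolding diag_free_def anti_free_def by simp
qed

lemma drain_gain:
  assumes "repr n X xs" "repr n Y ys" "repr n (mirror n Y) ys'" "b < n" "Y \<subseteq> {..<n}"
  shows "drain_line a b xs ys (drain_line a (n - 1 - b) xs ys' k) = k - gain n X Y (a, b)"
  using drain_line_diag[OF assms(1,2)] drain_line_diag[OF assms(1,3)] diag_free_mirror[OF assms(4,5)]
  by (simp add: gain_def)

fun pt :: "cell \<Rightarrow> nat \<times> nat" where "pt (Cell a b a' b' d m) = (a, b)"
fun cell_diag :: "cell \<Rightarrow> nat" where "cell_diag (Cell a b a' b' d m) = d"
fun cell_loss :: "cell \<Rightarrow> nat" where "cell_loss (Cell a b a' b' d m) = m"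

fun cell_ok :: "nat \<Rightarrow> cell \<Rightarrow> bool" where
  "cell_ok n (Cell a b a' b' d m) \<longleftrightarrow> a < n \<and> b < n \<and> a' = n - 1 - a \<and> b' = n - 1 - b \<and> d = a - b \<and>
     m = n - 4 - 2 * margin n (a, b)"

lemma cell_ok_mk_cell: "a < n \<Longrightarrow> b < n \<Longrightarrow> cell_ok n (mk_cell a b (n - 1 - a) (n - 1 - b))"
  by (simp add: mk_cell_def margin_def mult_2 eval_nat_numeral)

lemma cell_ok_loss: "cell_ok n c \<Longrightarrow> cell_loss c = n - 4 - 2 * margin n (pt c)"
  and cell_ok_diag: "cell_ok n c \<Longrightarrow> cell_diag c = fst (pt c) - snd (pt c)"
  by (cases c; simp)+

lemma pt_mk_cell [simp]: "pt (mk_cell a b a' b') = (a, b)"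
  by (simp add: mk_cell_def)

lemma pt_in_board: "cell_ok n c \<Longrightarrow> pt c \<in> board n"
  by (cases c) (auto simp: board_def)

text \<open>The row \<open>b\<close> of the border queen is known in advance and is marked from the
  start. Its column varies and is therefore absent from \<open>X\<close>.\<close>

definition masks_ok :: "nat \<Rightarrow> nat \<Rightarrow> (nat \<times> nat) set \<Rightarrow> bits \<Rightarrow> bits \<Rightarrow> bits \<Rightarrow> bool" where
  "masks_ok n b S X Y Y' \<longleftrightarrow> repr n (fst ` S) X \<and> repr n (insert b (snd ` S)) Y \<and>
     repr n (mirror n (insert b (snd ` S))) Y'"

lemma masks_ok_empty: "masks_ok n b {} (trues n) (punch b (trues n)) (punch (n - 1 - b) (trues n))"
  using repr_punch[OF repr_trues] by (auto simp: masks_ok_def repr_trues mirror_def)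

lemma masks_ok_insert:
  assumes "masks_ok n b S X Y Y'" "cell_ok n (Cell a c a' c' d m)"
  shows "masks_ok n b (insert (a, c) S) (punch a X) (punch c Y) (punch c' Y')"
proof -
  have "insert b (snd ` insert (a, c) S) = insert c (insert b (snd ` S))" by auto
  moreover have "mirror n (insert c Z) = insert c' (mirror n Z)" for Z using assms(2) by (simp add: mirror_def)
  ultimately show ?thesis using assms(1) unfolding masks_ok_def by (simp add: repr_punch)
qed

lemma drain_gains:
  assumes "cell_ok n p" "cell_ok n q" "cell_ok n r" "masks_ok n b S X Y Y'" "S \<subseteq> board n" "b < n"
  shows "drain_gains p q r X Y Y' k = k - (gain n (fst ` S) (insert b (snd ` S)) (pt p) +
    gain n (fst ` S) (insert b (snd ` S)) (pt q) + gain n (fst ` S) (insert b (snd ` S)) (pt r))"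
proof -
  have Y: "insert b (snd ` S) \<subseteq> {..<n}" using assms(5,6) by (auto simp: board_def)
  have "drain_line a c X Y (drain_line a (n - Suc c) X Y' j) = j - gain n (fst ` S) (insert b (snd ` S)) (a, c)"
    if "c < n" for a c j
    using drain_gain[OF _ _ _ that Y, of "fst ` S" X Y Y' a j] assms(4)[unfolded masks_ok_def] by simp
  then show ?thesis using assms(1-3) by (cases p; cases q; cases r) (simp add: add.assoc add.commute add.left_commute)
qed

lemma all_free:
  "all_free N b X Y D A a' a \<Longrightarrow> x < a \<Longrightarrow> many_free N (punch x X) Y (punch (a' + a - 1 - x + b) D) (punch (x + b) A)"
proof (induction N b X Y D A a' a rule: all_free.induct)
  case (2 N b X Y D A a' a)
  then show ?case by (cases "x = a") auto
qed simp

lemma good_of_uncovered: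
  assumes n: "8 \<le> n" and N: "(n - 8) * (n - 8) + 8 \<le> card (board n - covered n C)"
  shows "good n C"
proof -
  have "card (board n - covered n C) = n * n - card (covered n C)"
    by (subst card_Diff_subset) (auto simp: covered_def card_board)
  moreover obtain m where "n = m + 8" using n by (metis add.commute le_Suc_ex)
  ultimately show ?thesis using N by (auto simp: good_def algebra_simps)
qed

lemma free_cells_uncovered:
  assumes "repr n (fst ` S) X" "repr n (insert b (snd ` S)) Y"
    and "repr (2 * n - 1) ((\<lambda>q. n - 1 - fst q + snd q) ` S) D" "repr (2 * n - 1) ((\<lambda>q. fst q + snd q) ` S) A"
    and S: "S \<subseteq> board n" and m: "many_free N X Y D A"
  shows "N \<le> card (board n - covered n S)"
proof -
  let ?U = "{(x, y). free_at X x \<and> free_at Y y \<and> free_at D (len X - 1 - x + y) \<and> free_at A (x + y)}"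
  have "?U \<subseteq> board n - covered n S"
  proof
    fix p assume "p \<in> ?U"
    then obtain x y where p: "p = (x, y)" and f: "free_at X x" "free_at Y y" "free_at D (n - 1 - x + y)"
      "free_at A (x + y)" using assms(1) by (auto simp: repr_def)
    have lt: "x < n" "y < n" and X: "x \<notin> fst ` S" "y \<notin> snd ` S" using f(1,2) assms(1,2) by (auto simp: repr_def)
    have D: "n - 1 - x + y \<notin> (\<lambda>q. n - 1 - fst q + snd q) ` S" and A: "x + y \<notin> (\<lambda>q. fst q + snd q) ` S"
      using f(3,4) assms(3,4) unfolding repr_def by blast+
    have "\<not> hits q p" if q: "q \<in> S" for q
    proof
      assume "hits q p"
      then consider "x = fst q" | "y = snd q" | "x + snd q = fst q + y" | "x + y = fst q + snd q"
        unfolding hits_def p fst_conv snd_conv by blast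
      then show False
      proof cases
        case 3
        have "fst q < n" using q S by (auto simp: board_def)
        then have "n - 1 - x + y = n - 1 - fst q + snd q" using 3 lt by linarith
        then show False using D q by blast
      next
        case 4
        then show False using A q by blast
      qed (use X q in blast)+
    qed
    then show "p \<in> board n - covered n S" using lt p by (auto simp: covered_def board_def)
  qed
  then have "card ?U \<le> card (board n - covered n S)" by (rule card_mono[rotated]) simp
  then show ?thesis using many_free[OF m] by linarith
qed

lemma free4:
  assumes free: "free4 N b a' a p q r X Y" and a: "a' + a = n" "x < a" and b: "b < n"
    and ok: "cell_ok n p" "cell_ok n q" "cell_ok n r"
    and masks: "masks_ok n b {pt p, pt q, pt r} X Y Y'"
  shows "N \<le> card (board n - covered n {(x, b), pt p, pt q, pt r})"
proof -
  obtain a1 b1 a1' b1' d1 m1 where p: "p = Cell a1 b1 a1' b1' d1 m1" by (cases p)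
  obtain a2 b2 a2' b2' d2 m2 where q: "q = Cell a2 b2 a2' b2' d2 m2" by (cases q)
  obtain a3 b3 a3' b3' d3 m3 where r: "r = Cell a3 b3 a3' b3' d3 m3" by (cases r)
  have w: "a1 + a1' + Suc (b1 + b1') = 2 * n - 1" using ok(1) by (simp add: p)
  let ?D = "punch (a1' + b1) (punch (a2' + b2) (punch (a3' + b3) (trues (2 * n - 1))))"
  let ?A = "punch (a1 + b1) (punch (a2 + b2) (punch (a3 + b3) (trues (2 * n - 1))))"
  have D: "repr (2 * n - 1) {a1' + b1, a2' + b2, a3' + b3} ?D"
    and A: "repr (2 * n - 1) {a1 + b1, a2 + b2, a3 + b3} ?A"
    by (intro repr_punch repr_trues)+
  have "all_free N b X Y ?D ?A a' a" using free unfolding p q r free4.simps w .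
  then have m: "many_free N (punch x X) Y (punch (a' + a - 1 - x + b) ?D) (punch (x + b) ?A)"
    using a(2) by (rule all_free)
  let ?S = "{(x, b), pt p, pt q, pt r}"
  show ?thesis
  proof (rule free_cells_uncovered[OF _ _ _ _ _ m])
    show "repr n (fst ` ?S) (punch x X)" using repr_punch[of n _ X x] masks by (simp add: masks_ok_def)
    show "repr n (insert b (snd ` ?S)) Y" using masks by (simp add: masks_ok_def)
    have "(\<lambda>q. n - 1 - fst q + snd q) ` ?S = insert (a' + a - 1 - x + b) {a1' + b1, a2' + b2, a3' + b3}"
      using ok a by (simp add: p q r)
    then show "repr (2 * n - 1) ((\<lambda>q. n - 1 - fst q + snd q) ` ?S) (punch (a' + a - 1 - x + b) ?D)"
      using repr_punch[OF D] by simp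
    have "(\<lambda>q. fst q + snd q) ` ?S = insert (x + b) {a1 + b1, a2 + b2, a3 + b3}" by (simp add: p q r)
    then show "repr (2 * n - 1) ((\<lambda>q. fst q + snd q) ` ?S) (punch (x + b) ?A)"
      using repr_punch[OF A] by simp
    show "?S \<subseteq> board n" using ok[THEN pt_in_board] a b by (auto simp: board_def)
  qed
qed

section \<open>Soundness of the loops over three queens\<close>

definition param_ok :: "nat \<Rightarrow> nat \<Rightarrow> nat \<Rightarrow> param \<Rightarrow> bool" where
  "param_ok n b a P \<longleftrightarrow> 12 \<le> n \<and> a \<le> n \<and> (b = 0 \<or> b = n - 1) \<and>
     P = Param (7 * n - 51) (8 * n - 56) ((n - 8) * (n - 8) + 8) b (n - a) a"

definition trio_good :: "nat \<Rightarrow> nat \<Rightarrow> nat \<Rightarrow> cell \<Rightarrow> cell \<Rightarrow> cell \<Rightarrow> bool" where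
  "trio_good n b a p q r \<longleftrightarrow> (\<forall>x<a. good n {(x, b), pt p, pt q, pt r})"

lemma trio_good_commute: "trio_good n b a p q r = trio_good n b a q p r" "trio_good n b a p q r = trio_good n b a p r q"
  unfolding trio_good_def by (simp_all add: insert_commute)

lemma check3:
  assumes P: "param_ok n b a P" and ok: "cell_ok n p" "cell_ok n q" "cell_ok n r"
    and masks: "masks_ok n b {pt p, pt q, pt r} X Y Y'" and check: "check3 P p q r X Y Y'"
  shows "trio_good n b a p q r"
  unfolding trio_good_def
proof (intro allI impI)
  fix x assume x: "x < a"
  let ?S = "{pt p, pt q, pt r}" and ?C = "{(x, b), pt p, pt q, pt r}"
  have n: "12 \<le> n" "b < n" "b = 0 \<or> b = n - 1" and a: "a \<le> n"
    and PP: "P = Param (7 * n - 51) (8 * n - 56) ((n - 8) * (n - 8) + 8) b (n - a) a"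
    using P by (auto simp: param_ok_def)
  have S: "?S \<subseteq> board n" and C: "?C \<subseteq> board n" using ok[THEN pt_in_board] x a n by (auto simp: board_def)
  define g where "g = gain n (fst ` ?S) (snd ` ?C) (pt p) + gain n (fst ` ?S) (snd ` ?C) (pt q)
    + gain n (fst ` ?S) (snd ` ?C) (pt r)"
  have drain: "drain_gains p q r X Y Y' k = k - g" for k
    unfolding g_def using drain_gains[OF ok masks S n(2)] by simp
  have hX: "holes X = card (fst ` ?S)" and hY: "holes Y = card (snd ` ?C)"
    using masks S n(2) unfolding masks_ok_def by (auto intro!: holes simp: board_def)
  have goodI: "good n ?C" if "g + 52 \<le> 7 * n + (if card (fst ` ?S) < 3 \<or> card (snd ` ?C) < 4 then n - 5 else 0)"
    using that unfolding g_def by (intro good_of_three_gains[OF n(1) C refl _ refl]) (use n in auto)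
  \<comment> \<open>A nonzero rest of \<open>7 * n - 51 - g\<close> means
    \<open>g + 52 <= 7 * n\<close>. The second threshold is larger by \<open>n - 5\<close>, the
    saving from a shared line.\<close>
  consider (first) "g + 52 \<le> 7 * n" | (second) "card (fst ` ?S) < 3 \<or> card (snd ` ?C) < 4" "g + 57 \<le> 8 * n"
    | (third) "free4 ((n - 8) * (n - 8) + 8) b (n - a) a p q r X Y"
  proof (cases "7 * n - 51 - g")
    case Suc
    then show ?thesis using that(1) by linarith
  next
    case 0
    then have "check3_shared (holes X \<le> 2) (holes Y \<le> 3) P p q r X Y Y'"
      using check by (simp add: PP drain numeral_2_eq_2 numeral_3_eq_3)
    moreover have "holes X \<le> 2 \<longleftrightarrow> card (fst ` ?S) < 3" "holes Y \<le> 3 \<longleftrightarrow> card (snd ` ?C) < 4"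
      unfolding hX hY by linarith+
    ultimately have c: "check3_shared (card (fst ` ?S) < 3) (card (snd ` ?C) < 4) P p q r X Y Y'" by simp
    show ?thesis
    proof (cases "card (fst ` ?S) < 3 \<or> card (snd ` ?C) < 4")
      case True
      then have c': "check3_slow (8 * n - 56 - g) P p q r X Y"
        using c by (cases "card (fst ` ?S) < 3") (simp_all add: PP drain)
      show ?thesis
      proof (cases "8 * n - 56 - g")
        case 0
        then show ?thesis using c' that(3) by (simp add: PP)
      next
        case Suc
        then show ?thesis using True that(2) by linarith
      qed
    next
      case False
      then show ?thesis using c that(3) by (simp add: PP)
    qed
  qed
  then show "good n ?C"
  proof cases
    case third
    show ?thesis
      by (rule good_of_uncovered[OF _ free4[OF third _ x n(2) ok masks]]) (use n a in auto)
  qed (auto intro!: goodI)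
qed

lemma loop3:
  assumes loop: "loop3 P k e p q l X Y Y'" and P: "param_ok n b a P" and ok: "cell_ok n p" "cell_ok n q"
    and masks: "masks_ok n b {pt p, pt q} X Y Y'" and l: "\<forall>c\<in>set l. cell_ok n c"
    and r: "r \<in> set l" "cell_loss r \<le> k" "cell_diag r \<noteq> e"
  shows "trio_good n b a p q r"
proof -
  obtain x y x' y' d m where c: "r = Cell x y x' y' d m" by (cases r)
  have "check3_if True False P p q r X Y Y'"
    using loop r
  proof (induction l)
    case (Cons z l)
    then show ?case by (cases z) (auto simp: c)
  qed simp
  then have "check3 P p q r (punch x X) (punch y Y) (punch y' Y')" by (simp add: c)
  moreover have okr: "cell_ok n r" using l r(1) by blast
  moreover have "masks_ok n b {pt p, pt q, pt r} (punch x X) (punch y Y) (punch y' Y')"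
    using masks_ok_insert[OF masks okr[unfolded c]] by (simp add: c insert_commute)
  ultimately show ?thesis using check3[OF P ok] by blast
qed

lemma set_cons_if: "set (cons_if b s c l) = {x. b \<and> \<not> s \<and> x = c} \<union> set l"
  by (cases b; cases s) auto

lemma near_Cons: "near k e (c # l) = cons_if (cell_loss c \<le> k) (cell_diag c = e) c (near k e l)"
  by (cases c) simp

lemma set_near: "set (near k e l) = {c \<in> set l. cell_loss c \<le> k \<and> cell_diag c \<noteq> e}"
  by (induction l) (auto simp: near_Cons set_cons_if simp del: near.simps(2))

lemma keep_near_Cons: "keep_near k (c # l) = cons_if (cell_loss c \<le> k) False c (keep_near k l)"
  by (cases c) simp

lemma set_keep_near: "set (keep_near k l) = {c \<in> set l. cell_loss c \<le> k}"
  by (induction l) (auto simp: keep_near_Cons set_cons_if simp del: keep_near.simps(2))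

lemma loop2:
  assumes loop: "loop2 P k p l X Y Y'" and P: "param_ok n b a P" and ok: "cell_ok n p"
    and masks: "masks_ok n b {pt p} X Y Y'" and l: "\<forall>c\<in>set l. cell_ok n c"
    and qr: "q \<in> set l" "r \<in> set l" "cell_loss q + cell_loss r \<le> k" "cell_diag q \<noteq> cell_diag r"
  shows "trio_good n b a p q r"
  using loop l qr
proof (induction l)
  case (Cons z l)
  obtain x y x' y' d m where z: "z = Cell x y x' y' d m" by (cases z)
  have okz: "cell_ok n z" using Cons.prems by simp
  have l3: "loop3 P (k - m) d p z l (punch x X) (punch y Y) (punch y' Y')" using Cons.prems(1) by (simp add: z)
  have "masks_ok n b {pt p, pt z} (punch x X) (punch y Y) (punch y' Y')"
    using masks_ok_insert[OF masks okz[unfolded z]] by (simp add: z insert_commute)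
  note * = loop3[OF l3 P ok okz this]
  consider "q = z" | "r = z" "q \<noteq> z" | "q \<noteq> z" "r \<noteq> z" by blast
  then show ?case
  proof cases
    case 1
    then have "r \<in> set l" using Cons.prems by auto
    then show ?thesis using * Cons.prems 1 by (auto simp: z)
  next
    case 2
    then have "trio_good n b a p r q" using * Cons.prems by (auto simp: z)
    then show ?thesis by (simp add: trio_good_commute)
  next
    case 3
    then show ?thesis using Cons by (auto simp: z)
  qed
qed simp

lemma loop1:
  assumes loop: "loop1 P k l X Y Y'" and P: "param_ok n b a P"
    and masks: "masks_ok n b {} X Y Y'" and l: "\<forall>c\<in>set l. cell_ok n c"
    and pqr: "p \<in> set l" "q \<in> set l" "r \<in> set l" "cell_loss p + cell_loss q + cell_loss r \<le> k"
      "cell_diag p \<noteq> cell_diag q" "cell_diag p \<noteq> cell_diag r" "cell_diag q \<noteq> cell_diag r"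
  shows "trio_good n b a p q r"
  using loop l pqr
proof (induction l)
  case (Cons z l)
  obtain x y x' y' d m where z: "z = Cell x y x' y' d m" by (cases z)
  have okz: "cell_ok n z" using Cons.prems by simp
  have l2: "loop2 P (k - m) z (near (k - m) d l) (punch x X) (punch y Y) (punch y' Y')"
    using Cons.prems(1) by (simp add: z)
  have "masks_ok n b {pt z} (punch x X) (punch y Y) (punch y' Y')"
    using masks_ok_insert[OF masks okz[unfolded z]] by (simp add: z)
  note loop2[OF l2 P okz this]
  then have *: "trio_good n b a z s t" if "s \<in> set l" "t \<in> set l" "cell_loss z + cell_loss s + cell_loss t \<le> k"
    "cell_diag z \<noteq> cell_diag s" "cell_diag z \<noteq> cell_diag t" "cell_diag s \<noteq> cell_diag t" for s t
    using that Cons.prems(2) by (auto simp: set_near z)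
  have sets: "c \<in> set l" if "c \<in> set (z # l)" "c \<noteq> z" for c using that by auto
  \<comment> \<open>The loop meets each unordered trio in list order; whichever member comes first
    is moved to the front by \<open>trio_good_commute\<close>.\<close>
  consider "p = z" | "q = z" "p \<noteq> z" | "r = z" "p \<noteq> z" "q \<noteq> z" | "p \<noteq> z" "q \<noteq> z" "r \<noteq> z" by blast
  then show ?case
  proof cases
    case 1
    then have "q \<noteq> z" "r \<noteq> z" using Cons.prems by auto
    then show ?thesis using *[of q r] Cons.prems 1 sets by auto
  next
    case 2
    then have "p \<noteq> z" "r \<noteq> z" using Cons.prems by auto
    then have "trio_good n b a q p r" using *[of p r] Cons.prems 2 sets by auto
    then show ?thesis by (simp add: trio_good_commute)
  next
    case 3
    then have "trio_good n b a r p q" using *[of p q] Cons.prems sets by auto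
    then show ?thesis using trio_good_commute by metis
  next
    case 4
    then show ?thesis using Cons by (auto simp: z)
  qed
qed simp

lemma edge_loop2:
  assumes loop: "edge_loop2 P k ts p l X Y Y'" and P: "param_ok n b a P" and ok: "cell_ok n p"
    and masks: "masks_ok n b {pt p} X Y Y'" and l: "\<forall>c\<in>set l. cell_ok n c" "\<forall>c\<in>set ts. cell_ok n c"
    and qr: "q \<in> set l" "r \<in> set ts" "cell_loss r \<le> k" "cell_diag r = 0"
  shows "trio_good n b a p q r"
  using loop l(1) qr(1)
proof (induction l)
  case (Cons z l)
  obtain x y x' y' d m where z: "z = Cell x y x' y' d m" by (cases z)
  show ?case
  proof (cases "q = z")
    case True
    have okz: "cell_ok n z" using Cons.prems by simp
    have l3: "loop3 P k (Suc 0) p z ts (punch x X) (punch y Y) (punch y' Y')" using Cons.prems(1) by (simp add: z)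
    have "masks_ok n b {pt p, pt z} (punch x X) (punch y Y) (punch y' Y')"
      using masks_ok_insert[OF masks okz[unfolded z]] by (simp add: z insert_commute)
    then show ?thesis using loop3[OF l3 P ok okz] l(2) qr True by simp
  qed (use Cons in \<open>auto simp: z\<close>)
qed simp

lemma edge_loop1:
  assumes loop: "edge_loop1 P k ts j l X Y Y'" and P: "param_ok n b a P"
    and masks: "masks_ok n b {} X Y Y'" and l: "\<forall>c\<in>set l. cell_ok n c" "\<forall>c\<in>set ts. cell_ok n c"
    and pqr: "p \<in> set l" "q \<in> set l" "cell_loss p + cell_loss q \<le> j" "r \<in> set ts" "cell_loss r \<le> k" "cell_diag r = 0"
  shows "trio_good n b a p q r"
  using loop l(1) pqr(1-3)
proof (induction l)
  case (Cons z l)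
  obtain x y x' y' d m where z: "z = Cell x y x' y' d m" by (cases z)
  have okz: "cell_ok n z" using Cons.prems by simp
  have l2: "edge_loop2 P k ts z (keep_near (j - m) (z # l)) (punch x X) (punch y Y) (punch y' Y')"
    using Cons.prems(1) by (simp add: z)
  have "masks_ok n b {pt z} (punch x X) (punch y Y) (punch y' Y')"
    using masks_ok_insert[OF masks okz[unfolded z]] by (simp add: z)
  note k2 = edge_loop2[OF l2 P okz this]
  have *: "trio_good n b a z s r" if s: "s \<in> set (z # l)" "cell_loss z + cell_loss s \<le> j" for s
  proof (rule k2)
    show "\<forall>c\<in>set (keep_near (j - m) (z # l)). cell_ok n c"
      unfolding set_keep_near using Cons.prems(2) by blast
    have "cell_loss s \<le> j - m" using s(2) by (simp add: z)
    then show "s \<in> set (keep_near (j - m) (z # l))" unfolding set_keep_near using s(1) by blast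
  qed (use l(2) pqr(4-6) in simp_all)
  consider "p = z" | "q = z" | "p \<noteq> z" "q \<noteq> z" by blast
  then show ?case
  proof cases
    case 1
    then show ?thesis using *[of q] Cons.prems by simp
  next
    case 2
    then have "trio_good n b a q p r" using *[of p] Cons.prems by simp
    then show ?thesis by (simp add: trio_good_commute)
  next
    case 3
    then show ?thesis using Cons by (auto simp: z)
  qed
qed simp

lemma set_upfrom: "set (upfrom i k) = {i..<i + k}"
  by (induction k arbitrary: i) (auto simp: Suc_le_eq)

text \<open>Truncated subtraction turns the minimum of the two gain bounds into
  \<open>2 n - 8\<close> minus the loss. The four bounds then add up to \<open>8 n - 32\<close>
  minus the total loss, and \<open>8 n - 56\<close> is the target.\<close>

lemma good_of_losses:
  assumes n: "12 \<le> n" and C: "C \<subseteq> board n" "card C \<le> 4" and qs: "set qs = C" "length qs = 4"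
    and le: "24 \<le> (\<Sum>q\<leftarrow>qs. n - 4 - 2 * margin n q)"
  shows "good n C"
proof -
  have "min (2 * n - 8) (n - 4 + 2 * margin n q) = 2 * n - 8 - (n - 4 - 2 * margin n q)" for q
    using n by (simp add: min_def) 
  then have "min (2 * n - 8) (n - 4 + 2 * margin n q) + (n - 4 - 2 * margin n q) = 2 * n - 8" for q
    using n by simp
  then have "(\<Sum>q\<leftarrow>qs. min (2 * n - 8) (n - 4 + 2 * margin n q)) + (\<Sum>q\<leftarrow>qs. n - 4 - 2 * margin n q)
    = 4 * (2 * n - 8)"
    using qs(2) by (simp only: sum_list_addf[symmetric]) (simp add: sum_list_triv)
  then show ?thesis using le n by (intro good_of_margins[OF n C qs]) linarith
qed

lemma top_edge_False:
  assumes n: "12 \<le> n" and check: "n \<le> 27 \<Longrightarrow> check_top n" and bad: "bad n C"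
    and C4: "C = {t, p, q, r}" and t: "snd t = n - 1"
    and free: "\<And>q. q \<in> C \<Longrightarrow> fst q < n - 1 \<and> 0 < snd q"
    and ofs: "0 \<le> ofs p" "0 \<le> ofs q" "0 \<le> ofs r" "ofs p \<noteq> ofs q" "ofs p \<noteq> ofs r" "ofs q \<noteq> ofs r"
  shows False
proof -
  have C: "C \<subseteq> board n" "card C \<le> 4" "\<not> good n C" using bad by (auto simp: bad_def)
  define loss where "loss z = n - 4 - 2 * margin n z" for z
  have "margin n t = 0" using t by (simp add: margin_def)
  then have lt: "loss t = n - 4" by (simp add: loss_def)
  have small: "n + (loss p + loss q + loss r) < 28"
  proof (rule ccontr)
    assume "\<not> ?thesis"
    then have "good n C"
      by (intro good_of_losses[OF n C(1,2), of "[t, p, q, r]"]) (use lt n in \<open>auto simp: C4 loss_def\<close>)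
    then show False using C(3) by simp
  qed
  let ?c = "\<lambda>z. mk_cell (fst z) (snd z) (n - 1 - fst z) (n - 1 - snd z)"
  let ?l = "concat (map (\<lambda>a. keep_near (27 - n) (map (\<lambda>b. mk_cell a b (n - 1 - a) (n - 1 - b)) (upfrom 1 a))) (upfrom 1 (n - 2)))"
  let ?P = "Param (7 * n - 51) (8 * n - 56) ((n - 8) * (n - 8) + 8) (n - 1) (Suc 0) (n - 1)"
  have P: "param_ok n (n - 1) (n - 1) ?P" using n by (simp add: param_ok_def)
  have "loop1 ?P (27 - n) ?l (trues n) (punch (n - 1) (trues n)) (punch 0 (trues n))"
  proof -
    have e: "n + (n + (n + (n + (n + (n + n))))) = 7 * n" "n + 7 * n = 8 * n" by simp_all
    have "check_top n" using check small by simp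
    then show ?thesis unfolding check_top_def e .
  qed
  note main = loop1[OF this P]
  have masks: "masks_ok n (n - 1) {} (trues n) (punch (n - 1) (trues n)) (punch 0 (trues n))"
    using masks_ok_empty[of n "n - 1"] by simp
  have ok: "\<forall>c\<in>set ?l. cell_ok n c"
    by (auto simp: set_keep_near set_upfrom intro!: cell_ok_mk_cell[simplified])
  have lossc: "cell_loss (?c z) = loss z" "cell_diag (?c z) = fst z - snd z" if "z \<in> C" for z
  proof -
    have "cell_ok n (?c z)" using C(1) that by (intro cell_ok_mk_cell) (auto simp: board_def)
    then show "cell_loss (?c z) = loss z" "cell_diag (?c z) = fst z - snd z"
      by (simp_all only: cell_ok_loss cell_ok_diag pt_mk_cell loss_def prod.collapse)
  qed
  have mem: "?c z \<in> set ?l" if z: "z \<in> C" "0 \<le> ofs z" "loss z \<le> 27 - n" for z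
  proof -
    have "?c z \<in> set (keep_near (27 - n) (map (\<lambda>b. mk_cell (fst z) b (n - 1 - fst z) (n - 1 - b)) (upfrom 1 (fst z))))"
      unfolding set_keep_near set_map set_upfrom
      using lossc[OF z(1)] z free[OF z(1)] by (auto simp: ofs_def)
    moreover have "fst z \<in> set (upfrom 1 (n - 2))" unfolding set_upfrom
      using z free[OF z(1)] by (auto simp: ofs_def)
    ultimately show ?thesis unfolding set_concat set_map by blast
  qed
  have pqr: "p \<in> C" "q \<in> C" "r \<in> C" "t \<in> C" by (auto simp: C4)
  have "trio_good n (n - 1) (n - 1) (?c p) (?c q) (?c r)"
  proof (rule main[OF masks ok])
    show "?c p \<in> set ?l" "?c q \<in> set ?l" "?c r \<in> set ?l"
      using mem pqr ofs(1-3) small by auto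
    show "cell_loss (?c p) + cell_loss (?c q) + cell_loss (?c r) \<le> 27 - n"
      using lossc pqr small by simp
    show "cell_diag (?c p) \<noteq> cell_diag (?c q)" "cell_diag (?c p) \<noteq> cell_diag (?c r)"
      "cell_diag (?c q) \<noteq> cell_diag (?c r)"
      using lossc pqr ofs by (auto simp: ofs_def)
  qed
  then have "good n {(fst t, n - 1), p, q, r}"
    using free[OF pqr(4)] by (simp add: trio_good_def)
  moreover have "(fst t, n - 1) = t" using t by (simp add: prod_eq_iff)
  ultimately show False using C(3) C4 by simp
qed

lemma opposite_edges_False:
  assumes n: "12 \<le> n" and check: "n \<le> 15 \<Longrightarrow> check_edges n" and bad: "bad n C"
    and st: "s \<in> C" "snd s = n - 1" "t \<in> C" "snd t = 0"
  shows False
proof -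
  have C: "C \<subseteq> board n" "card C \<le> 4" "\<not> good n C" and fin: "finite C"
    using bad finite_bad by (auto simp: bad_def)
  have "s \<noteq> t" using st n by auto
  then have "card (C - {s, t}) \<le> 2" using st C(2) fin by (simp add: card_Diff_subset)
  \<comment> \<open>With fewer than four queens, \<open>p\<close> and \<open>q\<close> repeat
    members of \<open>C\<close>, so that \<open>t, p, q, s\<close> still lists all of
    \<open>C\<close>.\<close>
  then obtain p q where pq: "p \<in> C" "q \<in> C" "C - {s, t} \<subseteq> {p, q}"
  proof (cases "C - {s, t} = {}")
    case True
    then show ?thesis using that[of s s] st by blast
  next
    case False
    then obtain p where p: "p \<in> C - {s, t}" by blast
    show ?thesis
    proof (cases "C - {s, t} - {p} = {}")
      case True
      then show ?thesis using that[of p p] p by blast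
    next
      case False
      then obtain q where q: "q \<in> C - {s, t} - {p}" by blast
      have "C - {s, t} = {p, q}"
        using card_seteq[of "C - {s, t}" "{p, q}"] fin p q \<open>card (C - {s, t}) \<le> 2\<close> by auto
      then show ?thesis using that[of p q] p q by blast
    qed
  qed
  have C4: "C = {t, p, q, s}" using pq st by blast
  define loss where "loss z = n - 4 - 2 * margin n z" for z
  have "margin n t = 0" "margin n s = 0" using st by (simp_all add: margin_def)
  then have lt: "loss t = n - 4" "loss s = n - 4" by (simp_all add: loss_def)
  have small: "2 * n + (loss p + loss q) < 32"
  proof (rule ccontr)
    assume "\<not> ?thesis"
    then have "good n C"
      by (intro good_of_losses[OF n C(1,2), of "[t, p, q, s]"]) (use lt n in \<open>auto simp: C4 loss_def\<close>)
    then show False using C(3) by simp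
  qed
  let ?c = "\<lambda>z. mk_cell (fst z) (snd z) (n - 1 - fst z) (n - 1 - snd z)"
  let ?l = "concat (map (\<lambda>a. keep_near (31 - 2 * n) (map (\<lambda>b. mk_cell a b (n - 1 - a) (n - 1 - b)) (upfrom 0 n))) (upfrom 0 n))"
  let ?ts = "map (\<lambda>a. mk_cell a (n - 1) (n - 1 - a) 0) (upfrom 0 n)"
  let ?P = "Param (7 * n - 51) (8 * n - 56) ((n - 8) * (n - 8) + 8) 0 0 n"
  have P: "param_ok n 0 n ?P" using n by (simp add: param_ok_def)
  have k: "edge_loop1 ?P n ?ts (31 - 2 * n) ?l (trues n) (punch 0 (trues n)) (punch (n - 1) (trues n))"
  proof -
    have e: "n + (n + (n + (n + (n + (n + n))))) = 7 * n" "n + 7 * n = 8 * n" by simp_all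
    have "check_edges n" using check small by simp
    then show ?thesis unfolding check_edges_def e mult_2 .
  qed
  have masks: "masks_ok n 0 {} (trues n) (punch 0 (trues n)) (punch (n - 1) (trues n))"
    using masks_ok_empty[of n 0] by simp
  have ok: "\<forall>c\<in>set ?l. cell_ok n c"
    by (auto simp: set_keep_near set_upfrom intro!: cell_ok_mk_cell[simplified])
  have okt: "cell_ok n (mk_cell a (n - 1) (n - 1 - a) 0)" if "a < n" for a
    using cell_ok_mk_cell[of a n "n - 1"] that n by simp
  have ok': "\<forall>c\<in>set ?ts. cell_ok n c" unfolding set_map set_upfrom using okt by auto
  have lossc: "cell_loss (?c z) = loss z" if "z \<in> C" for z
  proof -
    have "cell_ok n (?c z)" using C(1) that by (intro cell_ok_mk_cell) (auto simp: board_def)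
    then show "cell_loss (?c z) = loss z" by (simp only: cell_ok_loss pt_mk_cell loss_def prod.collapse)
  qed
  have mem: "?c z \<in> set ?l" if z: "z \<in> C" "loss z \<le> 31 - 2 * n" for z
  proof -
    have lt: "fst z < n" "snd z < n" using z(1) C(1) by (auto simp: board_def)
    have "?c z \<in> set (keep_near (31 - 2 * n) (map (\<lambda>b. mk_cell (fst z) b (n - 1 - fst z) (n - 1 - b)) (upfrom 0 n)))"
      unfolding set_keep_near set_map set_upfrom using lossc[OF z(1)] z lt by auto
    moreover have "fst z \<in> set (upfrom 0 n)" unfolding set_upfrom using lt by simp
    ultimately show ?thesis unfolding set_concat set_map by blast
  qed
  have s: "fst s < n" using st(1) C(1) by (auto simp: board_def)
  have cs: "?c s = mk_cell (fst s) (n - 1) (n - 1 - fst s) 0" using st by simp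
  have "trio_good n 0 n (?c p) (?c q) (?c s)"
  proof (rule edge_loop1[OF k P masks ok ok'])
    show "?c p \<in> set ?l" "?c q \<in> set ?l" using mem pq small by auto
    show "cell_loss (?c p) + cell_loss (?c q) \<le> 31 - 2 * n" using lossc pq small by simp
    show "?c s \<in> set ?ts" unfolding cs set_map set_upfrom using s by auto
    show "cell_loss (?c s) \<le> n" using lossc[OF st(1)] lt by simp
    show "cell_diag (?c s) = 0" using s st(2) by (simp add: mk_cell_def)
  qed
  then have "good n {(fst t, 0), p, q, s}"
    using st(3) C(1) by (auto simp: trio_good_def board_def)
  moreover have "(fst t, 0) = t" using st by (simp add: prod_eq_iff)
  ultimately show False using C(3) C4 by simp
qed

section \<open>Soundness of the search on the board of size 11\<close>

lemma len_reverse: "len (reverse xs ys) = len xs + len ys"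
  by (induction xs arbitrary: ys) auto

lemma free_at_reverse:
  "free_at (reverse xs ys) i = (if i < len xs then free_at xs (len xs - 1 - i) else free_at ys (i - len xs))"
proof (induction xs arbitrary: ys i)
  case (Free xs)
  show ?case
  proof (cases "i < len xs")
    case True
    then have "len xs - i = Suc (len xs - 1 - i)" by simp
    then show ?thesis using True Free by simp
  next
    case False
    then show ?thesis using Free by (cases "i = len xs") (auto simp: Suc_diff_Suc[symmetric] dest: le_neq_implies_less)
  qed
next
  case (Taken xs)
  show ?case
  proof (cases "i < len xs")
    case True
    then have "len xs - i = Suc (len xs - 1 - i)" by simp
    then show ?thesis using True Taken by simp
  next
    case False
    then show ?thesis using Taken by (cases "i = len xs") (auto simp: Suc_diff_Suc[symmetric] dest: le_neq_implies_less)
  qed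
qed simp

lemma reverse_snoc: "reverse (reverse xs ys) End = reverse ys xs"
proof (induction xs arbitrary: ys)
qed auto

lemma repr_reverse:
  assumes "repr n S xs" "S \<subseteq> {..<n}"
  shows "repr n (mirror n S) (reverse xs End)"
  unfolding repr_def
proof (intro conjI allI)
  show "len (reverse xs End) = n" using assms by (simp add: repr_def len_reverse)
  fix i
  show "free_at (reverse xs End) i \<longleftrightarrow> i < n \<and> i \<notin> mirror n S"
  proof (cases "i < n")
    case True
    have "n - 1 - i \<in> S \<longleftrightarrow> i \<in> mirror n S"
    proof
      assume "n - 1 - i \<in> S"
      then show "i \<in> mirror n S" using True by (force simp: mirror_def)
    next
      assume "i \<in> mirror n S"
      then obtain s where "s \<in> S" "i = n - 1 - s" by (auto simp: mirror_def)
      moreover from this have "n - 1 - i = s" using assms(2) by auto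
      ultimately show "n - 1 - i \<in> S" by simp
    qed
    then show ?thesis using assms(1) True by (auto simp: repr_def free_at_reverse)
  qed (use assms(1) in \<open>simp add: repr_def free_at_reverse\<close>)
qed

lemma lex_le_total: "lex_le xs ys \<or> lex_le ys xs"
  by (induction xs ys rule: lex_le.induct) auto

lemma mem_patterns: "xs \<in> set (patterns (len xs) (holes xs))"
proof (induction xs)
  case (Free xs)
  then show ?case by (cases "holes xs") auto
qed auto

lemma ex_repr: "finite S \<Longrightarrow> \<exists>xs. repr n S xs"
  by (induction S rule: finite_induct) (use repr_trues repr_punch in blast)+

lemma set_infos: "set (infos j ms) =
    (\<lambda>m. Info m (reverse m End) (positions 0 j m)) ` {m \<in> set ms. lex_le m (reverse m End)}"
proof (induction ms)
  case (Cons m ms)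
  then show ?case by (cases "lex_le m (reverse m End)") auto
qed simp

fun pos_index :: "pos \<Rightarrow> nat" where "pos_index (Pos x y) = x"

lemma mem_positions:
  "Pos x y \<in> set (positions i j xs) \<longleftrightarrow> (\<exists>z<len xs. \<not> free_at xs z \<and> x = i + z \<and> y = j - z)"
proof (induction xs arbitrary: i j)
  case (Free xs)
  show ?case unfolding positions.simps Free len.simps Ex_less_Suc2 by auto
next
  case (Taken xs)
  show ?case unfolding positions.simps set_simps insert_iff Taken len.simps Ex_less_Suc2 by auto
qed simp

lemma length_positions: "length (positions i j xs) = holes xs"
  by (induction xs arbitrary: i j) auto

lemma distinct_positions: "distinct (map pos_index (positions i j xs))"
proof (induction xs arbitrary: i j)
  case (Taken xs)
  have "i \<notin> pos_index ` set (positions (Suc i) (j - Suc 0) xs)"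
  proof
    assume "i \<in> pos_index ` set (positions (Suc i) (j - Suc 0) xs)"
    then obtain c where c: "c \<in> set (positions (Suc i) (j - Suc 0) xs)" "pos_index c = i" by blast
    obtain x y where "c = Pos x y" by (cases c)
    then show False using c mem_positions[of x y "Suc i"] by simp
  qed
  then show ?case using Taken by simp
qed auto

lemma set_positions_repr:
  assumes "repr n S xs" "S \<subseteq> {..<n}"
  shows "set (positions 0 (n - 1) xs) = (\<lambda>x. Pos x (n - 1 - x)) ` S"
proof -
  have "c \<in> set (positions 0 (n - 1) xs) \<longleftrightarrow> c \<in> (\<lambda>x. Pos x (n - 1 - x)) ` S" for c
    using assms by (cases c) (auto simp: mem_positions repr_def)
  then show ?thesis by blast
qed

lemma pad_eq: "length l \<le> n \<Longrightarrow> pad n l y = l @ replicate (n - length l) y"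
  by (induction n l y rule: pad.induct) auto

text \<open>Produces a listing that fits the padded slots: one element for each value in
  \<open>xs\<close>, then the other elements of \<open>C\<close>, then repetitions of an arbitrary
  element up to length \<open>n\<close>.\<close>

lemma ex_representatives:
  assumes C: "finite C" "C \<noteq> {}" "card C \<le> n" and xs: "distinct (map f xs)" "f ` set xs = g ` C"
  obtains qs where "set qs = C" "length qs = n"
    "list_all2 (\<in>) qs (pad n (map (\<lambda>x. {q \<in> C. g q = f x}) xs) C)"
proof -
  have "\<forall>x\<in>set xs. \<exists>q\<in>C. g q = f x" using xs(2) by (metis imageE imageI)
  then obtain h where h: "\<And>x. x \<in> set xs \<Longrightarrow> h x \<in> C \<and> g (h x) = f x" by metis
  define q1 where "q1 = map h xs"
  have "map g q1 = map f xs" using h by (simp add: q1_def)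
  then have "distinct q1" using xs(1) distinct_map by metis
  have sub: "set q1 \<subseteq> C" using h by (auto simp: q1_def)
  obtain q2 where q2: "set q2 = C - set q1" "distinct q2" using C(1) finite_distinct_list[of "C - set q1"] by auto
  have l1: "length q1 = length xs" by (simp add: q1_def)
  have card: "length q1 + length q2 = card C"
    using sub C(1) \<open>distinct q1\<close> q2 by (metis card_Diff_subset card_mono distinct_card finite_set le_add_diff_inverse)
  obtain z where z: "z \<in> C" using C(2) by blast
  define q3 where "q3 = replicate (n - card C) z"
  let ?qs = "q1 @ q2 @ q3"
  have "set ?qs = C" using sub q2 z by (auto simp: q3_def)
  moreover have "length ?qs = n" using card C(3) by (simp add: q3_def)
  moreover have "list_all2 (\<in>) ?qs (pad n (map (\<lambda>x. {q \<in> C. g q = f x}) xs) C)"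
  proof -
    have "list_all2 (\<in>) q1 (map (\<lambda>x. {q \<in> C. g q = f x}) xs)"
      using h by (auto simp: q1_def list_all2_conv_all_nth)
    moreover have "list_all2 (\<in>) (q2 @ q3) (replicate (n - length xs) C)"
      using q2 z card C(3) l1
      by (auto simp: list_all2_conv_all_nth q3_def nth_append)
    moreover have "length xs \<le> n" using l1 card C(3) by linarith
    ultimately show ?thesis by (simp add: pad_eq list_all2_appendI)
  qed
  ultimately show ?thesis by (rule that)
qed

lemma sub_list: "sub_list k l = k - sum_list l"
  by (induction l arbitrary: k) auto

lemma minl_le: "x \<in> set l \<Longrightarrow> minl B l \<le> x"
  by (induction l) auto

lemma col_mins: "col_mins B xs ys X Y Y' = map (\<lambda>x. col_min B x ys X Y Y') xs"
  by (induction xs) auto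

lemma col_min_le: "y \<in> set ys \<Longrightarrow> col_min B x ys X Y Y' \<le> deficit B x y X Y Y'"
  by (induction ys) auto

lemma col_entries: "col_entries B x ys X Y Y' = map (\<lambda>y. entry_of B x y X Y Y') ys"
  by (induction ys) auto

lemma all_entries: "all_entries B xs ys X Y Y' = map (\<lambda>x. col_entries B x ys X Y Y') xs"
  by (induction xs) auto

fun entry_loss :: "entry \<Rightarrow> nat" where "entry_loss (Entry d x x' y y') = d"
fun entry_row :: "entry \<Rightarrow> nat" where "entry_row (Entry d x x' y y') = y"
fun entry_diag :: "entry \<Rightarrow> nat" where "entry_diag (Entry d x x' y y') = x' + y"
fun entry_anti :: "entry \<Rightarrow> nat" where "entry_anti (Entry d x x' y y') = x + y"
fun slot_entries :: "slot \<Rightarrow> entry list" where "slot_entries (Slot es m r) = es"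

lemma min_entry_le: "e \<in> set es \<Longrightarrow> min_entry B es \<le> entry_loss e"
proof (induction es)
  case (Cons a es)
  then show ?case by (cases a) auto
qed simp

fun slots_ok :: "slot list \<Rightarrow> bool" where
  "slots_ok [] = True"
| "slots_ok (Slot es m r # ss) \<longleftrightarrow> slots_ok ss \<and>
    (\<forall>l. list_all2 (\<lambda>e s. e \<in> set (slot_entries s)) l ss \<longrightarrow> r \<le> sum_list (map entry_loss l))"

text \<open>The last conjunct strengthens the induction: the bound \<open>m + r\<close> at the head
  of a slot list is what \<open>cons_slot\<close> stores as the rest of the next slot.\<close>

lemma slots:
  "slots_ok (slots B ess) \<and> map slot_entries (slots B ess) = ess \<and>
    (\<forall>es m r ss l. slots B ess = Slot es m r # ss \<longrightarrow> list_all2 (\<lambda>e s. e \<in> set (slot_entries s)) l (slots B ess) \<longrightarrow>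
      m + r \<le> sum_list (map entry_loss l))"
proof (induction ess)
  case (Cons es ess)
  let ?ss = "slots B ess"
  have IH: "slots_ok ?ss" "map slot_entries ?ss = ess"
    "\<And>es m r ss l. ?ss = Slot es m r # ss \<Longrightarrow> list_all2 (\<lambda>e s. e \<in> set (slot_entries s)) l ?ss \<Longrightarrow>
      m + r \<le> sum_list (map entry_loss l)" using Cons by blast+
  obtain r where r: "slots B (es # ess) = Slot es (min_entry B es) r # ?ss"
    and rl: "\<And>l. list_all2 (\<lambda>e s. e \<in> set (slot_entries s)) l ?ss \<Longrightarrow> r \<le> sum_list (map entry_loss l)"
  proof (cases ?ss)
    case Nil
    then show ?thesis using that[of 0] by simp
  next
    case (Cons a list)
    then obtain es' m' r' where "?ss = Slot es' m' r' # list" by (cases a) auto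
    then show ?thesis using that[of "m' + r'"] IH(3) by simp
  qed
  have "min_entry B es + r \<le> sum_list (map entry_loss l)"
    if l: "list_all2 (\<lambda>e s. e \<in> set (slot_entries s)) l (Slot es (min_entry B es) r # ?ss)" for l
  proof -
    obtain e l' where l': "l = e # l'" "e \<in> set es" "list_all2 (\<lambda>e s. e \<in> set (slot_entries s)) l' ?ss"
      using l by (auto simp: list_all2_Cons2)
    then show ?thesis using min_entry_le[OF l'(2), of B] rl[OF l'(3)] by simp
  qed
  then show ?case unfolding r using IH(1,2) rl by auto
qed simp

lemma remove_row_eq: "remove_row y l = filter (\<lambda>z. y \<noteq> z) l"
proof (induction l)
  case (Cons z l)
  then show ?case by (cases "y = z") auto
qed simp

lemma len_le_iff: "len_le ys ss \<longleftrightarrow> length ys \<le> length ss"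
  by (induction ys ss rule: len_le.induct) auto

lemma search_slot:
  "search_slot X Y k D A ys es r ss \<Longrightarrow> Entry d x x' y y' \<in> set es \<Longrightarrow>
    search_if (k - d - r) (len_le (remove_row y ys) ss) X Y (k - d) (punch (x' + y) D) (punch (x + y) A) (remove_row y ys) ss"
proof (induction es)
  case (Cons e es)
  then show ?case by (cases e) auto
qed simp

text \<open>The branch that follows \<open>es\<close> is either closed by its deficit, which is
  sound because \<open>r\<close> bounds the later losses from below, or it reaches a leaf.
  \<open>SD\<close> and \<open>SA\<close> collect the diagonals punched on the way.\<close>

lemma search:
  assumes "search X Y k D A ys ss" "slots_ok ss" "list_all2 (\<lambda>e s. e \<in> set (slot_entries s)) es ss"
    "distinct ys" "set ys \<subseteq> entry_row ` set es" "repr w SD D" "repr w SA A"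
  shows "k \<le> sum_list (map entry_loss es) \<or> (\<exists>D' A'. repr w (SD \<union> entry_diag ` set es) D' \<and>
    repr w (SA \<union> entry_anti ` set es) A' \<and> many_free 17 X Y D' A')"
  using assms
proof (induction ss arbitrary: k D A ys es SD SA)
  case Nil
  then show ?case by auto
next
  case (Cons s ss)
  obtain es0 m r where s: "s = Slot es0 m r" by (cases s)
  obtain e es' where es: "es = e # es'" "e \<in> set es0" "list_all2 (\<lambda>e s. e \<in> set (slot_entries s)) es' ss"
    using Cons.prems(3) by (auto simp: list_all2_Cons2 s)
  obtain d x x' y y' where e: "e = Entry d x x' y y'" by (cases e)
  have "search_slot X Y k D A ys es0 r ss" using Cons.prems(1) by (simp add: s)
  from search_slot[OF this es(2)[unfolded e]]
  have si: "search_if (k - d - r) (len_le (remove_row y ys) ss) X Y (k - d) (punch (x' + y) D) (punch (x + y) A) (remove_row y ys) ss" .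
  have sub: "set (remove_row y ys) \<subseteq> entry_row ` set es'" using Cons.prems(5) by (auto simp: remove_row_eq es e)
  have dis: "distinct (remove_row y ys)" using Cons.prems(4) by (simp add: remove_row_eq)
  \<comment> \<open>The entries still to come occupy all remaining rows, so by counting the cut on
    rows never discards this branch.\<close>
  have "length (remove_row y ys) \<le> card (entry_row ` set es')"
    using sub dis by (metis List.finite_set card_mono distinct_card finite_imageI)
  also have "\<dots> \<le> length es'" by (meson card_image_le card_length finite_set order_trans)
  also have "\<dots> = length ss" using es(3) by (rule list_all2_lengthD)
  finally have ll: "len_le (remove_row y ys) ss" by (simp add: len_le_iff)
  have r: "r \<le> sum_list (map entry_loss es')" using Cons.prems(2) es(3) by (simp add: s)
  show ?case
  proof (cases "k - d - r")
    case 0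
    then show ?thesis using r by (simp add: es e)
  next
    case (Suc j)
    then have se: "search X Y (k - d) (punch (x' + y) D) (punch (x + y) A) (remove_row y ys) ss" using si ll by simp
    have "k - d \<le> sum_list (map entry_loss es') \<or>
      (\<exists>D' A'. repr w (insert (x' + y) SD \<union> entry_diag ` set es') D' \<and>
        repr w (insert (x + y) SA \<union> entry_anti ` set es') A' \<and> many_free 17 X Y D' A')"
      by (rule Cons.IH[OF se _ es(3) dis sub repr_punch repr_punch]) (use Cons.prems in \<open>auto simp: s\<close>)
    then show ?thesis by (auto simp: es e)
  qed
qed

lemma deficit_eq:
  assumes "repr n X xs" "repr n Y ys" "Y \<subseteq> {..<n}" "b < n"
  shows "deficit B (Pos a (n - 1 - a)) (Pos b (n - 1 - b)) xs ys (reverse ys End) = B - gain n X Y (a, b)"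
  unfolding deficit.simps by (rule drain_gain) (use assms repr_reverse in auto)

lemma list_all2_pad:
  assumes "list_all2 (\<in>) qs (pad n (map S xs) C)" "length xs \<le> n"
    and "\<And>x q. x \<in> set xs \<Longrightarrow> q \<in> S x \<Longrightarrow> P q (g x)" "\<And>q. q \<in> C \<Longrightarrow> P q y"
  shows "list_all2 P qs (pad n (map g xs) y)"
proof -
  have "list_all2 (\<in>) qs (map S xs @ replicate (n - length xs) C)" using assms(1,2) by (simp add: pad_eq)
  then obtain us vs where qs: "qs = us @ vs" and us: "list_all2 (\<in>) us (map S xs)"
    and vs: "list_all2 (\<in>) vs (replicate (n - length xs) C)" by (auto simp: list_all2_append2)
  have "list_all2 P us (map g xs)"
    using us assms(3) by (auto simp: list_all2_conv_all_nth)
  moreover have "list_all2 P vs (replicate (n - length xs) y)"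
    using vs assms(4) by (auto simp: list_all2_conv_all_nth)
  ultimately show ?thesis using assms(2) by (simp add: pad_eq qs list_all2_appendI)
qed

lemma sum_list_le_map: "list_all2 (\<lambda>q m. m \<le> f q) qs ms \<Longrightarrow> sum_list ms \<le> sum_list (map f qs)"
  for f :: "'a \<Rightarrow> nat"
  by (induction rule: list_all2_induct) auto

lemma rows_eq: "rows ys = map pos_index ys"
  by (induction ys rule: rows.induct) auto

text \<open>If the four gains fall short of \<open>4 * B\<close> by at least \<open>k\<close>, the
  cover is at most 104. The condition on \<open>k\<close> is stated additively because the required
  deficit is negative when there are very few lines, and is then truncated to 0.\<close>

lemma pair_good:
  assumes C: "C \<subseteq> board 11" "card C \<le> 4" "C \<noteq> {}"
    and X: "repr 11 (fst ` C) X" and Y: "repr 11 (snd ` C) Y"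
    and B: "B = 2 * (11 - card (fst ` C))"
    and k: "8 * (11 - card (fst ` C)) + 17 \<le> k + (11 - card (fst ` C)) * (11 - card (snd ` C))"
    and pair: "pair B k 21 (Info X (reverse X End) (positions 0 10 X)) (Info Y (reverse Y End) (positions 0 10 Y))"
  shows "good 11 C"
proof -
  define xs where "xs = positions 0 10 X"
  define ys where "ys = positions 0 10 Y"
  let ?Y' = "reverse Y End"
  have fin: "finite C" using C(1) finite_subset finite_board by blast
  note cs = card_image_fst_snd[OF C(1,2)]
  have setxs: "set xs = (\<lambda>x. Pos x (10 - x)) ` fst ` C"
    unfolding xs_def using set_positions_repr[OF X cs(3)] by simp
  have setys: "set ys = (\<lambda>x. Pos x (10 - x)) ` snd ` C"
    unfolding ys_def using set_positions_repr[OF Y cs(4)] by simp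
  have idx: "pos_index ` set xs = fst ` C" "pos_index ` set ys = snd ` C"
    unfolding setxs setys image_image by simp_all
  have dxs: "distinct (map pos_index xs)" and dys: "distinct (map pos_index ys)"
    unfolding xs_def ys_def by (rule distinct_positions)+
  have "length xs = holes X" by (simp add: xs_def length_positions)
  also have "\<dots> = card (fst ` C)" by (rule holes[OF X cs(3)])
  finally have lxs: "length xs \<le> 4" using cs(1) by simp
  obtain qs where qs: "set qs = C" "length qs = 4"
    and l2: "list_all2 (\<in>) qs (pad 4 (map (\<lambda>x. {q \<in> C. fst q = pos_index x}) xs) C)"
    by (rule ex_representatives[OF fin C(3,2) dxs idx(1)])
  define g where "g q = gain 11 (fst ` C) (snd ` C) q" for q
  define ent where "ent q = Entry (B - g q) (fst q) (10 - fst q) (snd q) (10 - snd q)" for q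
  have gB: "g q \<le> B" for q unfolding g_def B by (rule gain_le_cols[OF cs(3)])
  have enough: "good 11 C" if "k \<le> (\<Sum>q\<leftarrow>qs. B - g q)"
  proof -
    have "(\<Sum>q\<leftarrow>qs. g q) + (\<Sum>q\<leftarrow>qs. B - g q) = (\<Sum>q\<leftarrow>qs. B)"
      unfolding sum_list_addf[symmetric] using gB by simp
    then have "(\<Sum>q\<leftarrow>qs. g q) + (\<Sum>q\<leftarrow>qs. B - g q) = 8 * (11 - card (fst ` C))"
      using qs(2) by (simp add: sum_list_triv B)
    then show ?thesis
      using card_covered_le_gain[OF C(1) qs(1)] that k unfolding good_def g_def by linarith
  qed
  have defi: "deficit B x y X Y ?Y' = B - g (pos_index x, pos_index y)" if "x \<in> set xs" "y \<in> set ys" for x y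
  proof -
    from that(1)[unfolded setxs] obtain a where a: "x = Pos a (10 - a)" by blast
    from that(2)[unfolded setys] obtain b where b: "y = Pos b (10 - b)" "b \<in> snd ` C" by blast
    have "b < 11" using b(2) cs(4) by blast
    then show ?thesis using deficit_eq[OF X Y cs(4), of b B a] by (simp add: a b g_def del: deficit.simps)
  qed
  have ex_y: "Pos (snd q) (10 - snd q) \<in> set ys" if "q \<in> C" for q
    unfolding setys using that by blast
  have loss_le: "col_min B x ys X Y ?Y' \<le> B - g q" if x: "x \<in> set xs" and q: "q \<in> C" "fst q = pos_index x" for x q
    using col_min_le[OF ex_y[OF q(1)], of B x X Y ?Y'] defi[OF x ex_y[OF q(1)]] q(2) prod.collapse[of q] by simp
  have mem: "ent q \<in> set (col_entries B x ys X Y ?Y')" if x: "x \<in> set xs" and q: "q \<in> C" "fst q = pos_index x" for x q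
  proof -
    from x[unfolded setxs] obtain a where a: "x = Pos a (10 - a)" by blast
    have "ent q = entry_of B x (Pos (snd q) (10 - snd q)) X Y ?Y'"
      using defi[OF x ex_y[OF q(1)]] q(2) prod.collapse[of q] by (simp add: a ent_def del: deficit.simps)
    then show ?thesis unfolding col_entries using ex_y[OF q(1)] by simp
  qed
  have ex_x: "\<exists>x\<in>set xs. fst q = pos_index x" if "q \<in> C" for q
    using that setxs by auto
  let ?ms = "col_mins B xs ys X Y ?Y'" and ?ess = "all_entries B xs ys X Y ?Y'"
  have "list_all2 (\<lambda>q m. m \<le> B - g q) qs (pad 4 ?ms (minl B ?ms))"
    unfolding col_mins
  proof (rule list_all2_pad[OF l2 lxs])
    show "minl B (map (\<lambda>x. col_min B x ys X Y ?Y') xs) \<le> B - g q" if q: "q \<in> C" for q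
    proof -
      obtain x where x: "x \<in> set xs" "fst q = pos_index x" using ex_x[OF q] by blast
      have "minl B (map (\<lambda>x. col_min B x ys X Y ?Y') xs) \<le> col_min B x ys X Y ?Y'"
        using x(1) by (intro minl_le) simp
      then show ?thesis using loss_le[OF x(1) q x(2)] by linarith
    qed
  qed (use loss_le in blast)
  then have mins: "sum_list (pad 4 ?ms (minl B ?ms)) \<le> (\<Sum>q\<leftarrow>qs. B - g q)" by (rule sum_list_le_map)
  have "list_all2 (\<lambda>q l. ent q \<in> set l) qs (pad 4 ?ess (concat ?ess))"
    unfolding all_entries
  proof (rule list_all2_pad[OF l2 lxs])
    show "ent q \<in> set (concat (map (\<lambda>x. col_entries B x ys X Y ?Y') xs))" if q: "q \<in> C" for q
    proof -
      obtain x where x: "x \<in> set xs" "fst q = pos_index x" using ex_x[OF q] by blast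
      then show ?thesis using mem[OF x(1) q x(2)] unfolding set_concat set_map by blast
    qed
  qed (use mem in blast)
  moreover have "map slot_entries (slots B l) = l" for l using slots by blast
  ultimately have "list_all2 (\<lambda>q l. ent q \<in> set l) qs (map slot_entries (slots B (pad 4 ?ess (concat ?ess))))"
    by simp
  then have ents: "list_all2 (\<lambda>e s. e \<in> set (slot_entries s)) (map ent qs) (slots B (pad 4 ?ess (concat ?ess)))"
    unfolding list_all2_map1 list_all2_map2 .
  have four: "four = 4" by (simp add: four_def)
  have p: "pair_if (sub_list k (pad 4 ?ms (minl B ?ms))) B k 21 (Info X (reverse X End) xs) (Info Y ?Y' ys)"
    using pair by (simp add: xs_def ys_def four)
  show ?thesis
  proof (cases "sub_list k (pad 4 ?ms (minl B ?ms))")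
    case 0
    then show ?thesis using mins by (intro enough) (simp add: sub_list)
  next
    case (Suc j)
    then have se: "search X Y k (trues 21) (trues 21) (rows ys) (slots B (pad 4 ?ess (concat ?ess)))"
      using p by (simp add: four)
    have "k \<le> sum_list (map entry_loss (map ent qs)) \<or> (\<exists>D' A'. repr 21 ({} \<union> entry_diag ` set (map ent qs)) D' \<and>
        repr 21 ({} \<union> entry_anti ` set (map ent qs)) A' \<and> many_free 17 X Y D' A')"
    proof (rule search[OF se _ ents _ _ repr_trues repr_trues])
      show "slots_ok (slots B (pad 4 ?ess (concat ?ess)))" using slots by blast
      show "distinct (rows ys)" using dys by (simp add: rows_eq)
      have "set (rows ys) = snd ` C" unfolding rows_eq set_map idx(2) ..
      also have "\<dots> = entry_row ` set (map ent qs)" using qs(1) by (simp add: image_image ent_def)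
      finally show "set (rows ys) \<subseteq> entry_row ` set (map ent qs)" by simp
    qed
    then show ?thesis
    proof (elim disjE exE conjE)
      assume "k \<le> sum_list (map entry_loss (map ent qs))"
      then show ?thesis by (intro enough) (simp add: ent_def o_def)
    next
      fix D' A'
      assume D: "repr 21 ({} \<union> entry_diag ` set (map ent qs)) D'" "repr 21 ({} \<union> entry_anti ` set (map ent qs)) A'"
        and m: "many_free 17 X Y D' A'"
      \<comment> \<open>Inserting the row of an actual queen changes nothing; this fits the row set
        to the form needed for the uncovered squares.\<close>
      obtain z where "z \<in> C" using C(3) by blast
      then have "insert (snd z) (snd ` C) = snd ` C" by blast
      then have Yz: "repr 11 (insert (snd z) (snd ` C)) Y" using Y by simp
      have "17 \<le> card (board 11 - covered 11 C)"
        by (rule free_cells_uncovered[OF X Yz _ _ C(1) m]) (use D qs(1) in \<open>simp_all add: image_image ent_def\<close>)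
      then show ?thesis by (intro good_of_uncovered) simp_all
    qed
  qed
qed

definition info_of :: "bits \<Rightarrow> info" where
  "info_of X = Info X (reverse X End) (positions 0 10 X)"

text \<open>Testing a pair with exchanged roles is equally good, since transposing the configuration
  exchanges its columns and rows. This halves the number of pairs of counts to be evaluated when
  they differ.\<close>

definition base_check :: "nat \<Rightarrow> nat \<Rightarrow> bool" where
  "base_check c r \<longleftrightarrow> (\<forall>X \<in> {X \<in> set (patterns 11 c). lex_le X (reverse X End)}.
     \<forall>Y \<in> {Y \<in> set (patterns 11 r). lex_le Y (reverse Y End)}.
       let p = \<lambda>c r X Y. pair (2 * (11 - c)) (8 * (11 - c) + 17 - (11 - c) * (11 - r)) 21 (info_of X) (info_of Y)
       in p c r X Y \<or> p r c Y X)"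

lemma pair_all: "pair_all B k w i js \<Longrightarrow> j \<in> set js \<Longrightarrow> pair B k w i j"
  by (induction js) auto

lemma pairs_same: "pairs_same B k w l \<Longrightarrow> i \<in> set l \<Longrightarrow> j \<in> set l \<Longrightarrow> pair B k w i j \<or> pair B k w j i"
proof (induction l)
  case (Cons z l)
  then have all: "pair_all B k w z (z # l)" and rest: "pairs_same B k w l" by auto
  consider "i = z" | "j = z" | "i \<noteq> z" "j \<noteq> z" by blast
  then show ?case
  proof cases
    case 1
    then show ?thesis using pair_all[OF all Cons.prems(3)] by blast
  next
    case 2
    then show ?thesis using pair_all[OF all Cons.prems(2)] by blast
  next
    case 3
    then show ?thesis using Cons.IH[OF rest] Cons.prems by simp
  qed
qed simp

lemma pairs_diff: "pairs_diff B k w l l' \<Longrightarrow> i \<in> set l \<Longrightarrow> j \<in> set l' \<Longrightarrow> pair B k w i j"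
  by (induction l) (auto intro: pair_all)

lemma info_of_mem: "X \<in> set (patterns 11 c) \<Longrightarrow> lex_le X (reverse X End) \<Longrightarrow> info_of X \<in> set (infos 10 (patterns 11 c))"
  unfolding set_infos info_of_def by blast

lemma base_check_same:
  assumes "pairs_same (2 * (11 - c)) (8 * (11 - c) + 17 - (11 - c) * (11 - c)) 21 (infos 10 (patterns 11 c))"
  shows "base_check c c"
  unfolding base_check_def Let_def using pairs_same[OF assms] info_of_mem by blast

lemma base_check_diff:
  assumes "pairs_diff (2 * (11 - c)) (8 * (11 - c) + 17 - (11 - c) * (11 - r)) 21
    (infos 10 (patterns 11 c)) (infos 10 (patterns 11 r))"
  shows "base_check c r" "base_check r c"
  unfolding base_check_def Let_def using pairs_diff[OF assms] info_of_mem by blast+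

lemma good_of_pair:
  assumes bad: "bad 11 C" and X: "repr 11 (fst ` C) X" and Y: "repr 11 (snd ` C) Y" and "C \<noteq> {}"
    and c: "card (fst ` C) = c" "card (snd ` C) = r"
    and pair: "pair (2 * (11 - c)) (8 * (11 - c) + 17 - (11 - c) * (11 - r)) 21 (info_of X) (info_of Y)"
  shows False
proof -
  have "good 11 C"
    by (rule pair_good[OF _ _ \<open>C \<noteq> {}\<close> X Y _ _ pair[unfolded info_of_def]])
      (use bad in \<open>auto simp: bad_def c\<close>)
  then show False using bad by (simp add: bad_def)
qed

text \<open>Reflecting columns leaves the set of rows unchanged, so the same normalization can
  afterwards be applied to the transposed configuration without spoiling the first one.\<close>

lemma canonical_columns:
  assumes "bad n C"
  obtains C' X where "bad n C'" "repr n (fst ` C') X" "lex_le X (reverse X End)" "snd ` C' = snd ` C"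
proof -
  have sub: "fst ` C \<subseteq> {..<n}" using assms by (auto simp: bad_def board_def)
  obtain X where X: "repr n (fst ` C) X" using ex_repr[of "fst ` C" n] finite_bad[OF assms] by blast
  show ?thesis
  proof (cases "lex_le X (reverse X End)")
    case True
    then show ?thesis using that assms X by blast
  next
    case False
    have "fst ` flip n ` C = mirror n (fst ` C)" by (simp add: image_image flip_def mirror_def)
    then have "repr n (fst ` flip n ` C) (reverse X End)" using repr_reverse[OF X sub] by simp
    moreover have "lex_le (reverse X End) (reverse (reverse X End) End)"
      using False lex_le_total[of X "reverse X End"] by (simp add: reverse_snoc)
    moreover have "snd ` flip n ` C = snd ` C" by (simp add: image_image flip_def)
    ultimately show ?thesis using that bad_flip[OF assms] by blast
  qed
qed

lemma bounded_11:
  assumes check: "\<And>c r. c \<in> {1..4} \<Longrightarrow> r \<in> {1..4} \<Longrightarrow> base_check c r"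
  shows "bounded 11"
  unfolding bounded_def
proof (intro allI impI, rule ccontr)
  fix C0 assume "C0 \<subseteq> board 11" "card C0 \<le> 4" "\<not> good 11 C0"
  then have "bad 11 C0" by (simp add: bad_def)
  then obtain C1 X where C1: "bad 11 C1" "repr 11 (fst ` C1) X" and X: "lex_le X (reverse X End)"
    by (rule canonical_columns)
  obtain C2 Y where C2: "bad 11 C2" "repr 11 (fst ` C2) Y" "snd ` C2 = snd ` prod.swap ` C1"
    and Y: "lex_le Y (reverse Y End)" by (rule canonical_columns[OF bad_swap[OF C1(1)]])
  define C where "C = prod.swap ` C2"
  have bad: "bad 11 C" unfolding C_def by (rule bad_swap[OF C2(1)])
  have "fst ` C = fst ` C1" using C2(3) by (simp add: C_def image_image)
  then have rX: "repr 11 (fst ` C) X" using C1(2) by simp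
  have "snd ` C = fst ` C2" by (simp add: C_def image_image)
  then have rY: "repr 11 (snd ` C) Y" using C2(2) by simp
  have ne: "C \<noteq> {}" using bad by (auto simp: bad_def good_def covered_def)
  define c r where "c = card (fst ` C)" and "r = card (snd ` C)"
  have Cb: "C \<subseteq> board 11" "card C \<le> 4" using bad by (auto simp: bad_def)
  note cs = card_image_fst_snd[OF Cb]
  have "c \<noteq> 0" "r \<noteq> 0" using ne finite_bad[OF bad] by (simp_all add: c_def r_def)
  then have cr: "c \<in> {1..4}" "r \<in> {1..4}" using cs(1,2) by (auto simp: c_def r_def)
  have "X \<in> set (patterns 11 c)" "Y \<in> set (patterns 11 r)"
    using mem_patterns[of X] mem_patterns[of Y] rX rY holes[OF rX cs(3)] holes[OF rY cs(4)]
    by (simp_all add: repr_def c_def r_def)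
  then consider
    "pair (2 * (11 - c)) (8 * (11 - c) + 17 - (11 - c) * (11 - r)) 21 (info_of X) (info_of Y)" |
    "pair (2 * (11 - r)) (8 * (11 - r) + 17 - (11 - r) * (11 - c)) 21 (info_of Y) (info_of X)"
    using check[OF cr] X Y unfolding base_check_def Let_def by blast
  then show False
  proof cases
    case 1
    show False by (rule good_of_pair[OF bad rX rY ne _ _ 1]) (simp_all add: c_def r_def)
  next
    case 2
    have "fst ` prod.swap ` C = snd ` C" "snd ` prod.swap ` C = fst ` C" by (simp_all add: image_image)
    then show False
      by (intro good_of_pair[OF bad_swap[OF bad] _ _ _ _ _ 2]) (use rX rY ne in \<open>simp_all add: c_def r_def\<close>)
  qed
qed

section \<open>Evaluation\<close>

lemma check_top_12: "check_top 12"
  by (simp only: check_simps)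

lemma check_top_13: "check_top 13"
  by (simp only: check_simps)

lemma check_top_14: "check_top 14"
  by (simp only: check_simps)

lemma check_top_15: "check_top 15"
  by (simp only: check_simps)

lemma check_top_16: "check_top 16"
  by (simp only: check_simps)

lemma check_top_17: "check_top 17"
  by (simp only: check_simps)

lemma check_top_18: "check_top 18"
  by (simp only: check_simps)

lemma check_top_19: "check_top 19"
  by (simp only: check_simps)

lemma check_top_20: "check_top 20"
  by (simp only: check_simps)

lemma check_top_21: "check_top 21"
  by (simp only: check_simps)

lemma check_top_22: "check_top 22"
  by (simp only: check_simps)

lemma check_top_23: "check_top 23"
  by (simp only: check_simps)

lemma check_top_24: "check_top 24"
  by (simp only: check_simps)

lemma check_top_25: "check_top 25"
  by (simp only: check_simps)

lemma check_top_26: "check_top 26"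
  by (simp only: check_simps)

lemma check_top_27: "check_top 27"
  by (simp only: check_simps)

lemma check_edges_12: "check_edges 12"
  by (simp only: check_simps)

lemma check_edges_13: "check_edges 13"
  by (simp only: check_simps)

lemma check_edges_14: "check_edges 14"
  by (simp only: check_simps)

lemma check_edges_15: "check_edges 15"
  by (simp only: check_simps)

text \<open>With \<open>c\<close> occupied columns and \<open>r\<close> occupied rows the parameters are \<open>2 (11 - c)\<close>, which bounds a gain,
  the required total \<open>8 (11 - c) + 17 - (11 - c) (11 - r)\<close> by which the four gains must fall short of it, and the
  number \<open>2 * 11 - 1\<close> of diagonals.\<close>

lemma check_base_44: "pairs_same 14 24 21 (infos 10 (patterns 11 4))"
  by (simp only: check_simps)

lemma check_base_43: "pairs_diff 14 17 21 (infos 10 (patterns 11 4)) (infos 10 (patterns 11 3))"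
  by (simp only: check_simps)

lemma check_base_42: "pairs_diff 14 10 21 (infos 10 (patterns 11 4)) (infos 10 (patterns 11 2))"
  by (simp only: check_simps)

lemma check_base_41: "pairs_diff 14 3 21 (infos 10 (patterns 11 4)) (infos 10 (patterns 11 1))"
  by (simp only: check_simps)

lemma check_base_33: "pairs_same 16 17 21 (infos 10 (patterns 11 3))"
  by (simp only: check_simps)

lemma check_base_32: "pairs_diff 16 9 21 (infos 10 (patterns 11 3)) (infos 10 (patterns 11 2))"
  by (simp only: check_simps)

lemma check_base_31: "pairs_diff 16 1 21 (infos 10 (patterns 11 3)) (infos 10 (patterns 11 1))"
  by (simp only: check_simps)

lemma check_base_22: "pairs_same 18 8 21 (infos 10 (patterns 11 2))"
  by (simp only: check_simps)

lemma check_base_21: "pairs_diff 18 0 21 (infos 10 (patterns 11 2)) (infos 10 (patterns 11 1))"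
  by (simp only: check_simps)

lemma check_base_11: "pairs_same 20 0 21 (infos 10 (patterns 11 1))"
  by (simp only: check_simps)

lemma check_top:
  assumes "12 \<le> n" "n \<le> 27"
  shows "check_top n"
proof -
  have "n = 12 \<or> n = 13 \<or> n = 14 \<or> n = 15 \<or> n = 16 \<or> n = 17 \<or> n = 18 \<or> n = 19 \<or> n = 20 \<or> n = 21 \<or> n = 22 \<or> n = 23 \<or> n = 24 \<or> n = 25 \<or> n = 26 \<or> n = 27" using assms by presburger
  then show ?thesis by (elim disjE) (simp_all only: check_top_12 check_top_13 check_top_14 check_top_15 check_top_16 check_top_17 check_top_18 check_top_19 check_top_20 check_top_21 check_top_22 check_top_23 check_top_24 check_top_25 check_top_26 check_top_27)
qed

lemma check_edges:
  assumes "12 \<le> n" "n \<le> 15"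
  shows "check_edges n"
proof -
  have "n = 12 \<or> n = 13 \<or> n = 14 \<or> n = 15" using assms by presburger
  then show ?thesis by (elim disjE) (simp_all only: check_edges_12 check_edges_13 check_edges_14 check_edges_15)
qed

lemma base_check:
  assumes "c \<in> {1..4}" "r \<in> {1..4}"
  shows "base_check c r"
proof -
  have "base_check 4 4" by (rule base_check_same) (use check_base_44 in simp)
  moreover have "base_check 4 3" "base_check 3 4" by (rule base_check_diff, use check_base_43 in simp)+
  moreover have "base_check 4 2" "base_check 2 4" by (rule base_check_diff, use check_base_42 in simp)+
  moreover have "base_check 4 1" "base_check 1 4" by (rule base_check_diff, use check_base_41 in simp)+
  moreover have "base_check 3 3" by (rule base_check_same) (use check_base_33 in simp)
  moreover have "base_check 3 2" "base_check 2 3" by (rule base_check_diff, use check_base_32 in simp)+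
  moreover have "base_check 3 1" "base_check 1 3" by (rule base_check_diff, use check_base_31 in simp)+
  moreover have "base_check 2 2" by (rule base_check_same) (use check_base_22 in simp)
  moreover have "base_check 2 1" "base_check 1 2" by (rule base_check_diff, use check_base_21 in simp)+
  moreover have "base_check 1 1" by (rule base_check_same) (use check_base_11 in simp)
  moreover have "c = 1 \<or> c = 2 \<or> c = 3 \<or> c = 4" "r = 1 \<or> r = 2 \<or> r = 3 \<or> r = 4" using assms by auto
  ultimately show ?thesis by auto
qed

section \<open>The upper bound\<close>

lemma three_elements:
  assumes "3 \<le> card S"
  obtains a b c where "a \<in> S" "b \<in> S" "c \<in> S" "a \<noteq> b" "a \<noteq> c" "b \<noteq> c"
  using assms that unfolding numeral_3_eq_3 card_le_Suc_iff by auto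

text \<open>The queen \<open>t\<close> has negative offset, since its column is below
  \<open>n\<close>. The three distinct nonnegative offsets left over by \<open>good_Suc\<close> must
  then belong to the other three queens, so the trio search applies.\<close>

lemma top_occupied_False:
  assumes bd: "bounded n" and n: "11 \<le> n" and bad: "bad (Suc n) C"
    and free: "\<And>q. q \<in> C \<Longrightarrow> fst q < n \<and> 0 < snd q" and t: "t \<in> C" "snd t = n"
  shows False
proof -
  have C: "C \<subseteq> board (Suc n)" "card C \<le> 4" "\<not> good (Suc n) C" using bad by (auto simp: bad_def)
  then have "\<not> card {z \<in> ofs ` C. 0 \<le> z} \<le> 2" using good_Suc[OF bd C(1,2)] free by blast
  then have "3 \<le> card {z \<in> ofs ` C. 0 \<le> z}" by linarith
  then obtain x y z where xyz: "x \<in> {z \<in> ofs ` C. 0 \<le> z}" "y \<in> {z \<in> ofs ` C. 0 \<le> z}"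
    "z \<in> {z \<in> ofs ` C. 0 \<le> z}" "x \<noteq> y" "x \<noteq> z" "y \<noteq> z" by (rule three_elements)
  then obtain p q r where pqr: "p \<in> C" "q \<in> C" "r \<in> C" and ofs: "x = ofs p" "y = ofs q" "z = ofs r" by auto
  have nn: "0 \<le> ofs p" "0 \<le> ofs q" "0 \<le> ofs r" using xyz ofs by auto
  have "ofs t < 0" using free[OF t(1)] t(2) by (simp add: ofs_def)
  then have "t \<noteq> p" "t \<noteq> q" "t \<noteq> r" "p \<noteq> q" "p \<noteq> r" "q \<noteq> r" using nn xyz ofs by auto
  then have "card {t, p, q, r} = 4" by simp
  then have C4: "{t, p, q, r} = C" using card_seteq[OF finite_bad[OF bad], of "{t, p, q, r}"] pqr t C(2) by auto
  show False
  proof (rule top_edge_False[OF _ check_top bad C4[symmetric]])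
    show "fst z < Suc n - 1 \<and> 0 < snd z" if "z \<in> C" for z using free[OF that] by simp
  qed (use n t(2) nn xyz(4-6) ofs in simp_all)
qed

lemma corner_free_False:
  assumes bd: "bounded n" and n: "11 \<le> n" and bad: "bad (Suc n) C"
    and free: "\<And>q. q \<in> C \<Longrightarrow> fst q < n \<and> 0 < snd q"
  shows False
proof -
  have C: "C \<subseteq> board (Suc n)" "card C \<le> 4" "\<not> good (Suc n) C" using bad by (auto simp: bad_def)
  consider (top) t where "t \<in> C" "snd t = n" | (left) t where "t \<in> C" "fst t = 0"
    | (none) "\<forall>q\<in>C. snd q < n \<and> 0 < fst q"
  proof (cases "\<exists>t\<in>C. snd t = n \<or> fst t = 0")
    case True
    then show ?thesis using that(1,2) by blast
  next
    case False
    have "snd q < n \<and> 0 < fst q" if q: "q \<in> C" for q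
    proof -
      have "snd q < Suc n" using C(1) q by (auto simp: board_def)
      moreover have "snd q \<noteq> n" "fst q \<noteq> 0" using False q by auto
      ultimately show ?thesis by simp
    qed
    then show ?thesis using that(3) by blast
  qed
  then show False
  proof cases
    case top
    then show ?thesis using top_occupied_False[OF bd n bad free] by blast
  next
    case left
    \<comment> \<open>Reflection in the antidiagonal through the corner \<open>(n, 0)\<close> of the
      board's complement is not meant here: the map sends the first column to the last row and
      exchanges the two empty lines, so both remain empty.\<close>
    let ?f = "\<lambda>q. (n - snd q, n - fst q)"
    have "bad (Suc n) (flip (Suc n) ` prod.swap ` flip (Suc n) ` prod.swap ` prod.swap ` C)"
      by (intro bad_flip bad_swap bad)
    moreover have "flip (Suc n) ` prod.swap ` flip (Suc n) ` prod.swap ` prod.swap ` C = ?f ` C"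
      unfolding image_image by (rule image_cong) (simp_all add: flip_def)
    ultimately have "bad (Suc n) (?f ` C)" by simp
    moreover have "fst q < n \<and> 0 < snd q" if q: "q \<in> ?f ` C" for q
    proof -
      obtain z where "z \<in> C" "q = ?f z" using q by blast
      then show ?thesis using free[of z] n by simp
    qed
    moreover have "?f t \<in> ?f ` C" "snd (?f t) = n" using left by auto
    ultimately show ?thesis using top_occupied_False[OF bd n] by blast
  next
    case none
    \<comment> \<open>With all four border lines empty, the deletion can also be made at the
      opposite corner, seen through transposition. Its failure gives three offsets
      \<open><= 0\<close> besides three offsets \<open>>= 0\<close>; only 0 lies in both sets, so at
      least five offsets would be needed for four queens.\<close>
    let ?U = "{z \<in> ofs ` C. 0 \<le> z}" and ?V = "{z \<in> ofs ` C. z \<le> 0}"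
    have fin: "finite (ofs ` C)" using finite_bad[OF bad] by simp
    have "\<not> card ?U \<le> 2" using good_Suc[OF bd C(1,2)] free C(3) by blast
    then have 1: "3 \<le> card ?U" by linarith
    have sw: "\<not> good (Suc n) (prod.swap ` C)" "prod.swap ` C \<subseteq> board (Suc n)" "card (prod.swap ` C) \<le> 4"
      using bad_swap[OF bad] by (auto simp: bad_def)
    have "fst q < n \<and> 0 < snd q" if "q \<in> prod.swap ` C" for q using that none by auto
    then have "\<not> card {z \<in> ofs ` prod.swap ` C. 0 \<le> z} \<le> 2" using good_Suc[OF bd sw(2,3)] sw(1) by blast
    then have "3 \<le> card {z \<in> ofs ` prod.swap ` C. 0 \<le> z}" by linarith
    moreover have "ofs ` prod.swap ` C = uminus ` ofs ` C"
      unfolding image_image by (rule image_cong) (simp_all add: ofs_def)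
    then have "{z \<in> ofs ` prod.swap ` C. 0 \<le> z} = uminus ` ?V" by auto
    ultimately have 2: "3 \<le> card ?V" by (simp add: card_image)
    have "card ?U + card ?V = card (?U \<union> ?V) + card (?U \<inter> ?V)"
      by (rule card_Un_Int) (use fin in auto)
    also have "card (?U \<union> ?V) \<le> card (ofs ` C)" by (rule card_mono) (use fin in auto)
    also have "card (ofs ` C) \<le> 4" using card_image_le[OF finite_bad[OF bad], of ofs] C(2) by simp
    also have "card (?U \<inter> ?V) \<le> card {0::int}" by (rule card_mono) auto
    finally show ?thesis using 1 2 by simp
  qed
qed

lemma bounded_Suc:
  assumes bd: "bounded n" and n: "11 \<le> n"
  shows "bounded (Suc n)"
  unfolding bounded_def
proof (intro allI impI, rule ccontr)
  fix C assume "C \<subseteq> board (Suc n)" "card C \<le> 4" "\<not> good (Suc n) C"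
  then have bad: "bad (Suc n) C" by (simp add: bad_def)
  have lt: "fst q \<le> n \<and> snd q \<le> n" if "q \<in> C" for q
    using that \<open>C \<subseteq> board (Suc n)\<close> by (auto simp: board_def)
  have rows: "(\<forall>q\<in>C. 0 < snd q) \<or> (\<forall>q\<in>C. snd q < n)"
  proof (rule ccontr)
    assume "\<not> ?thesis"
    then obtain s t where "s \<in> C" "snd s = 0" "t \<in> C" "snd t = n" using lt by (metis le_neq_implies_less gr0I)
    then show False using opposite_edges_False[OF _ check_edges bad, of t s] n by simp
  qed
  have cols: "(\<forall>q\<in>C. 0 < fst q) \<or> (\<forall>q\<in>C. fst q < n)"
  proof (rule ccontr)
    assume "\<not> ?thesis"
    then obtain s t where "s \<in> C" "fst s = 0" "t \<in> C" "fst t = n" using lt by (metis le_neq_implies_less gr0I)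
    then show False using opposite_edges_False[OF _ check_edges bad_swap[OF bad], of "prod.swap t" "prod.swap s"] n by simp
  qed
  \<comment> \<open>Reflecting columns reduces both alternatives to an empty last column. The
    statement is kept general in \<open>C'\<close> because it is applied again after a reflection of
    rows.\<close>
  have cols': False if bad': "bad (Suc n) C'" and rows': "\<forall>q\<in>C'. 0 < snd q"
    and cols': "(\<forall>q\<in>C'. 0 < fst q) \<or> (\<forall>q\<in>C'. fst q < n)" for C'
    using cols'
  proof
    assume "\<forall>q\<in>C'. fst q < n"
    with rows' show False by (intro corner_free_False[OF bd n bad']) blast
  next
    assume "\<forall>q\<in>C'. 0 < fst q"
    then have "\<forall>q\<in>flip (Suc n) ` C'. fst q < n \<and> 0 < snd q" using rows' n by (simp add: flip_def)
    then show False by (intro corner_free_False[OF bd n bad_flip[OF bad']]) blast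
  qed
  show False using rows
  proof
    assume "\<forall>q\<in>C. 0 < snd q"
    then show False using cols cols' bad by blast
  next
    assume lt_n: "\<forall>q\<in>C. snd q < n"
    \<comment> \<open>A reflection of rows is a reflection of columns conjugated by
      transposition.\<close>
    let ?C = "prod.swap ` flip (Suc n) ` prod.swap ` C"
    have eq: "?C = (\<lambda>q. (fst q, n - snd q)) ` C"
      unfolding image_image by (rule image_cong) (simp_all add: flip_def)
    have "bad (Suc n) ?C" by (intro bad_flip bad_swap bad)
    moreover have "\<forall>q\<in>?C. 0 < snd q" unfolding eq using lt_n n by simp
    moreover have "(\<forall>q\<in>?C. 0 < fst q) \<or> (\<forall>q\<in>?C. fst q < n)" unfolding eq using cols by simp
    ultimately show False by (rule cols')
  qed
qed

lemma bounded: "11 \<le> n \<Longrightarrow> bounded n"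
  by (induction n rule: dec_induct) (auto intro: bounded_Suc bounded_11 base_check)

section \<open>The pinwheel configuration\<close>

definition sees :: "int \<times> int \<Rightarrow> int \<times> int \<Rightarrow> bool" where
  "sees q p \<longleftrightarrow> fst p = fst q \<or> snd p = snd q \<or> fst p - snd p = fst q - snd q \<or> fst p + snd p = fst q + snd q"

lemma sees_iff: "sees q p \<longleftrightarrow> p = q \<or> p \<in> attacked q"
proof -
  obtain a b where q: "q = (a, b)" by (cases q)
  obtain x y where p: "p = (x, y)" by (cases p)
  have "p \<in> attacked q \<longleftrightarrow> (\<exists>i. i \<noteq> 0 \<and> x = a + i \<and> y = b) \<or> (\<exists>i. i \<noteq> 0 \<and> x = a \<and> y = b + i) \<or>
      (\<exists>i. i \<noteq> 0 \<and> x = a + i \<and> y = b + i) \<or> (\<exists>i. i \<noteq> 0 \<and> x = a + i \<and> y = b - i)"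
    unfolding attacked_def q p by auto
  also have "\<dots> \<longleftrightarrow> (x \<noteq> a \<and> y = b) \<or> (x = a \<and> y \<noteq> b) \<or> (x \<noteq> a \<and> y - b = x - a) \<or> (x \<noteq> a \<and> b - y = x - a)"
    by presburger
  finally show ?thesis unfolding sees_def q p by auto
qed

lemma cover_eq: "cover n C = card {p \<in> B_n n. \<exists>q\<in>C. sees q p}"
proof -
  have "(C \<union> attacked_set C) \<inter> B_n n = {p \<in> B_n n. \<exists>q\<in>C. sees q p}"
    unfolding attacked_set_def sees_iff by auto
  then show ?thesis by (simp add: cover_def)
qed

section \<open>Translation from centred integer coordinates\<close>

definition low :: "nat \<Rightarrow> int" where "low n = (2 - int n) div 2"

lemma I_n_eq: "I_n n = {low n..<low n + int n}"
proof -
  have "int n div 2 = low n + int n - 1" unfolding low_def by presburger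
  then show ?thesis unfolding I_n_def low_def by auto
qed

lemma finite_B_n [simp]: "finite (B_n n)"
  by (simp add: B_n_def I_n_def)

definition to_nat :: "nat \<Rightarrow> int \<times> int \<Rightarrow> nat \<times> nat" where
  "to_nat n p = (nat (fst p - low n), nat (snd p - low n))"

lemma to_nat_mem: "p \<in> B_n n \<Longrightarrow> to_nat n p \<in> board n"
  by (auto simp: to_nat_def board_def B_n_def I_n_eq)

lemma int_to_nat: "p \<in> B_n n \<Longrightarrow> int (fst (to_nat n p)) = fst p - low n \<and> int (snd (to_nat n p)) = snd p - low n"
  by (auto simp: to_nat_def B_n_def I_n_eq)

lemma hits_to_nat:
  assumes "p \<in> B_n n" "q \<in> B_n n"
  shows "hits (to_nat n q) (to_nat n p) \<longleftrightarrow> sees q p"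
  using int_to_nat[OF assms(1)] int_to_nat[OF assms(2)] unfolding hits_def sees_def by linarith

lemma inj_on_to_nat: "inj_on (to_nat n) (B_n n)"
proof (rule inj_onI)
  fix p q assume "p \<in> B_n n" "q \<in> B_n n" "to_nat n p = to_nat n q"
  then show "p = q" using int_to_nat[of p n] int_to_nat[of q n] by (simp add: prod_eq_iff)
qed

lemma cover_le:
  assumes bd: "bounded n" and C: "C \<subseteq> B_n n" "card C = 4"
  shows "cover n C + 72 \<le> 16 * n"
proof -
  have fin: "finite C" using C(1) finite_subset by (blast intro: finite_B_n)
  have "to_nat n ` C \<subseteq> board n" using C(1) to_nat_mem by blast
  moreover have "card (to_nat n ` C) \<le> 4" using card_image_le[OF fin, of "to_nat n"] C(2) by simp
  ultimately have "card (covered n (to_nat n ` C)) + 72 \<le> 16 * n"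
    using bd unfolding bounded_def good_def by blast
  moreover have "card (to_nat n ` {p \<in> B_n n. \<exists>q\<in>C. sees q p}) \<le> card (covered n (to_nat n ` C))"
  proof (rule card_mono)
    show "to_nat n ` {p \<in> B_n n. \<exists>q\<in>C. sees q p} \<subseteq> covered n (to_nat n ` C)"
      using C(1) hits_to_nat to_nat_mem unfolding covered_def by blast
  qed simp
  moreover have "card (to_nat n ` {p \<in> B_n n. \<exists>q\<in>C. sees q p}) = cover n C"
    unfolding cover_eq by (rule card_image) (rule inj_on_subset[OF inj_on_to_nat], blast)
  ultimately show ?thesis by simp
qed

section \<open>Lower bound for the pinwheel\<close>

abbreviation pinwheel :: "(int \<times> int) set" where
  "pinwheel \<equiv> {(-1, 0), (0, 2), (1, -1), (2, 1)}"

lemma cover_pinwheel_11: "104 \<le> cover 11 pinwheel"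
proof -
  define S where "S = {p \<in> B_n 11. \<exists>q\<in>pinwheel. sees q p}"
  \<comment> \<open>These are the 17 squares that no queen of the pinwheel sees on the board of size
    11, so \<open>121 - 17 = 104\<close> are covered.\<close>
  define l :: "(int \<times> int) list" where "l = [(-5, -5), (-5, -2), (-5, 3), (-4, -4), (-4, 5), (-3, -3), (-3, 4), (-2, -5), (-2, -2), (-2, 3), (3, -5), (3, -2), (3, 3), (4, -3), (4, 4), (5, -4), (5, 5)]"
  have I: "I_n 11 = {-5, -4, -3, -2, -1, 0, 1, 2, 3, 4, 5}" unfolding I_n_def set_eq_iff by simp presburger
  have all: "\<forall>x\<in>I_n 11. \<forall>y\<in>I_n 11. (\<exists>q\<in>pinwheel. sees q (x, y)) \<or> (x, y) \<in> set l"
    unfolding I l_def by (simp add: sees_def)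
  have "B_n 11 \<subseteq> S \<union> set l"
  proof
    fix p assume p: "p \<in> B_n 11"
    obtain x y where xy: "p = (x, y)" by (cases p)
    then have "x \<in> I_n 11" "y \<in> I_n 11" using p unfolding B_n_def by simp_all
    then have "(\<exists>q\<in>pinwheel. sees q p) \<or> p \<in> set l" unfolding xy by (rule bspec[OF bspec[OF all]])
    then show "p \<in> S \<union> set l" using p unfolding S_def by blast
  qed
  then have "card (B_n 11) \<le> card (S \<union> set l)" by (rule card_mono[rotated]) (simp add: S_def)
  also have "\<dots> \<le> card S + card (set l)" by (rule card_Un_le)
  also have "card (set l) \<le> 17" by (rule order_trans[OF card_length]) (simp add: l_def)
  finally have "card (B_n 11) \<le> card S + 17" by simp
  moreover have "card (B_n 11) = 121" by (simp add: B_n_def I)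
  moreover have "cover 11 pinwheel = card S" by (simp only: cover_eq S_def)
  ultimately show ?thesis by linarith
qed

lemma ring_card:
  fixes h :: int
  assumes "finite K" "h \<notin> K"
  shows "card (K \<times> {h} \<union> {h} \<times> K) = 2 * card K"
  by (subst card_Un_disjoint) (use assms in \<open>auto simp: card_cartesian_product\<close>)

text \<open>Enlarging the board adds one row and one column at the same coordinate \<open>h\<close>.
  The queens occupy \<open>{-1, 0, 1, 2}\<close> both as columns and as rows, and their offsets 1,
  -1, 2, -2 are closed under negation. Hence the same eight coordinates \<open>K\<close> are covered
  on both new lines, which gives 16 new squares apart from the corner.\<close>

lemma cover_pinwheel_Suc:
  assumes n: "11 \<le> n"
  shows "cover n pinwheel + 16 \<le> cover (Suc n) pinwheel"
proof -
  let ?S = "\<lambda>n. {p \<in> B_n n. \<exists>q\<in>pinwheel. sees q p}"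
  obtain h K where K: "finite K" "card K = 8" "h \<notin> I_n n" "h \<notin> K" "I_n n \<subseteq> I_n (Suc n)" "h \<in> I_n (Suc n)"
    "K \<subseteq> I_n (Suc n)" "\<And>k. k \<in> K \<Longrightarrow> (\<exists>q\<in>pinwheel. sees q (k, h)) \<and> (\<exists>q\<in>pinwheel. sees q (h, k))"
  proof (cases "even n")
    case False
    then obtain m where m: "n = 2 * m + 1" by (rule oddE)
    define h where "h = int m + 1"
    have h: "6 \<le> h" using n m by (simp add: h_def)
    have I: "I_n n = {1 - h..h - 1}" "I_n (Suc n) = {1 - h..h}" unfolding I_n_def m h_def by auto
    \<comment> \<open>The last four coordinates come from diagonals: offsets give
      \<open>h - 1\<close> and \<open>h - 2\<close>, and the coordinate sums 2 and 3 give
      \<open>2 - h\<close> and \<open>3 - h\<close>. The sums -1 and 0 lead outside the board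
      here.\<close>
    have "card {-1, 0, 1, 2, h - 1, h - 2, 2 - h, 3 - h} = 8" using h by simp
    then show ?thesis
      by (intro that[of "{-1, 0, 1, 2, h - 1, h - 2, 2 - h, 3 - h}" h])
        (use h in \<open>auto simp: I sees_def\<close>)
  next
    case True
    then obtain m where m: "n = 2 * m" by (rule evenE)
    define h where "h = - int m"
    have h: "h \<le> -6" using n m by (simp add: h_def)
    have I: "I_n n = {h + 1..-h}" "I_n (Suc n) = {h..-h}" unfolding I_n_def m h_def by auto
    \<comment> \<open>On the opposite side the sums -1 and 0 give \<open>- h - 1\<close> and
      \<open>- h\<close>, while the sums 2 and 3 lead outside.\<close>
    have "card {-1, 0, 1, 2, h + 1, h + 2, - h - 1, - h} = 8" using h by simp
    then show ?thesis
      by (intro that[of "{-1, 0, 1, 2, h + 1, h + 2, - h - 1, - h}" h])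
        (use h in \<open>auto simp: I sees_def\<close>)
  qed
  have "?S n \<union> (K \<times> {h} \<union> {h} \<times> K) \<subseteq> ?S (Suc n)"
    using K(5-8) unfolding B_n_def by blast
  then have "card (?S n \<union> (K \<times> {h} \<union> {h} \<times> K)) \<le> card (?S (Suc n))" by (intro card_mono) auto
  moreover have "card (?S n \<union> (K \<times> {h} \<union> {h} \<times> K)) = card (?S n) + card (K \<times> {h} \<union> {h} \<times> K)"
  proof (rule card_Un_disjoint)
    show "finite (?S n)" by (rule finite_subset[OF _ finite_B_n]) blast
    show "finite (K \<times> {h} \<union> {h} \<times> K)" using K(1) by simp
    show "?S n \<inter> (K \<times> {h} \<union> {h} \<times> K) = {}" using K(3) unfolding B_n_def by blast
  qed
  ultimately show ?thesis using ring_card[OF K(1,4)] K(2) by (simp add: cover_eq)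
qed

lemma cover_pinwheel:
  assumes "11 \<le> n"
  shows "16 * n \<le> cover n pinwheel + 72"
  using assms
proof (induction n rule: dec_induct)
  case base
  then show ?case using cover_pinwheel_11 by simp
next
  case (step n)
  then show ?case using cover_pinwheel_Suc[OF step(1)] by simp
qed

lemma optimal_of_bounded:
  assumes "10 < n" "bounded n"
  shows "n_optimal n 4 pinwheel"
proof -
  have "pinwheel \<subseteq> B_n n" using assms(1) by (auto simp: B_n_def I_n_def)
  moreover have "cover n C \<le> cover n pinwheel" if "card C = 4" "C \<subseteq> B_n n" for C
    using cover_le[OF assms(2) that(2,1)] cover_pinwheel[of n] assms(1) by simp
  ultimately show ?thesis by (simp add: n_optimal_def)
qed

theorem mainTheorem3:
  fixes n :: nat
  assumes "n > 10"
  shows "n_optimal n 4 {(-1, 0), (0, 2), (1, -1), (2, 1)}"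
  using optimal_of_bounded[OF assms bounded] assms by simp

end
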